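(* Let $F$ be a fixed graph and let $e\in E(F)$. Let $\mathcal{H}$ be a Berge-$F$-free hypergraph on $n$ vertices such that every edge of $\mathcal{H}$ has size at least $R(F, F \setminus e)$. If $w:\mathbb{Z}_+\rightarrow \mathbb{Z}_+$ is any weight function such that $w(m)=o(m^2)$ as $m\to\infty$, then \[ \sum_{h \in E(\mathcal{H})} w(|h|) = o(n^2). \] That is, for every graph $F$, every $e\in E(F)$ and every $w:\mathbb{Z}_+\to\mathbb{Z}_+$ with $w(m)=o(m^2)$, for every $\varepsilon>0$ there is $n_0$ such that for all $n\ge n_0$, every Berge-$F$-free hypergraph $\mathcal{H}$ on $n$ vertices with $|h|\ge R(F,F\setminus e)$ for all $h\in E(\mathcal{H})$ satisfies $\sum_{h \in E(\mathcal{H})} w(|h|) \le \varepsilon n^2$.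
   Context: Graphs are finite and simple. Hypergraphs are finite, not necessarily uniform, and have no repeated hyperedges: $E(\mathcal{H})$ is a set of subsets of the vertex set $V(\mathcal{H})$; $|h|$ denotes the number of vertices of a hyperedge $h$. $\mathbb{Z}_+$ is the set of positive integers. Given a graph $F$, a hypergraph $\mathcal{H}$ is called Berge-$F$ if there is a bijection $f:E(F)\to E(\mathcal{H})$ such that $e\subseteq f(e)$ for every $e\in E(F)$, where the vertices of $F$ are identified with distinct vertices of $\mathcal{H}$. Equivalently, one can embed a distinct graph edge into each hyperedge of $\mathcal{H}$ so as to obtain a copy of $F$. A hypergraph is Berge-$F$-free if it contains no subhypergraph that is Berge-$F$ (for any such identification of the vertices of $F$ with vertices of the hypergraph). For $e\in E(F)$, $F\setminus e$ denotes the graph with $V(F\setminus e)=V(F)$ and $E(F\setminus e)=E(F)\setminus\{e\}$. For graphs $F$ and $G$, $R(F,G)$ denotes the 2-color Ramsey number: the smallest $N$ such that every coloring of the edges of the complete graph $K_N$ with two colors contains a (not necessarily induced) copy of $F$ all of whose edges have the first color or a copy of $G$ all of whose edges have the second color. *)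

theory Defs
  imports "HOL-Library.Ramsey" "HOL-Library.Landau_Symbols" Complex_Main
begin

text \<open>
  A hypergraph is a pair of a vertex set and a set of hyperedges; a (simple) graph is a
  hypergraph all of whose edges have exactly two vertices. Isolated vertices are part of the data.
\<close>

type_synonym 'a hypergraph = "'a set \<times> 'a set set"

definition verts :: "'a hypergraph \<Rightarrow> 'a set" where
  "verts H = fst H"

definition edges :: "'a hypergraph \<Rightarrow> 'a set set" where
  "edges H = snd H"

definition is_hypergraph :: "'a hypergraph \<Rightarrow> bool" where
  "is_hypergraph H \<longleftrightarrow> finite (verts H) \<and> (\<forall>h\<in>edges H. h \<subseteq> verts H)"

definition is_graph :: "'a hypergraph \<Rightarrow> bool" where
  "is_graph G \<longleftrightarrow> is_hypergraph G \<and> (\<forall>e\<in>edges G. card e = 2)"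

definition delete_edge :: "'a hypergraph \<Rightarrow> 'a set \<Rightarrow> 'a hypergraph" where
  "delete_edge F e = (verts F, edges F - {e})"

definition subhypergraph :: "'a hypergraph \<Rightarrow> 'a hypergraph \<Rightarrow> bool" where
  "subhypergraph H' H \<longleftrightarrow>
     is_hypergraph H' \<and> verts H' \<subseteq> verts H \<and> edges H' \<subseteq> edges H"

text \<open>The injection \<open>\<phi>\<close> is the identification of the vertices of \<open>F\<close> with distinct vertices of \<open>H\<close>.\<close>

definition is_Berge :: "'a hypergraph \<Rightarrow> 'b hypergraph \<Rightarrow> bool" where
  "is_Berge F H \<longleftrightarrow>
     (\<exists>\<phi> f. inj_on \<phi> (verts F) \<and> \<phi> ` verts F \<subseteq> verts H \<and>
            bij_betw f (edges F) (edges H) \<and> (\<forall>e\<in>edges F. \<phi> ` e \<subseteq> f e))"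

definition Berge_free :: "'a hypergraph \<Rightarrow> 'b hypergraph \<Rightarrow> bool" where
  "Berge_free F H \<longleftrightarrow> \<not> (\<exists>H'. subhypergraph H' H \<and> is_Berge F H')"

text \<open>Copies of graphs need not be induced.\<close>

definition contains_copy :: "'a hypergraph \<Rightarrow> 'b hypergraph \<Rightarrow> bool" where
  "contains_copy F G \<longleftrightarrow>
     (\<exists>\<phi>. inj_on \<phi> (verts F) \<and> \<phi> ` verts F \<subseteq> verts G \<and> (\<forall>e\<in>edges F. \<phi> ` e \<in> edges G))"

text \<open>
  \<open>c\<close> colours the edges of the complete graph on \<open>{..<N}\<close>; its values on other sets are
  irrelevant. For finite graphs such an \<open>N\<close> exists by Ramsey's theorem, so the least one is
  well defined.
\<close>

definition ramsey_number :: "'a hypergraph \<Rightarrow> 'b hypergraph \<Rightarrow> nat" where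
  "ramsey_number F G =
     (LEAST N. \<forall>c :: nat set \<Rightarrow> bool.
        contains_copy F ({..<N}, {s \<in> nsets {..<N} 2. c s}) \<or>
        contains_copy G ({..<N}, {s \<in> nsets {..<N} 2. \<not> c s}))"

end

theory Submission
  imports Defs "HOL-Analysis.Convex"
begin

text \<open>
  Call a set of vertices thin if fewer than \<open>|E(F)|\<close> hyperedges contain it, and thick otherwise.
  A thick pair can always be assigned a hyperedge that is not yet in use. Hence if a hyperedge \<open>h\<close>
  contained a copy of \<open>F \<setminus> e\<close> all of whose pairs are thick, then \<open>h\<close> itself could represent \<open>e\<close>,
  the other pairs could be represented greedily, and a Berge copy of \<open>F\<close> would arise. By the choice
  of the Ramsey number, every set of at least \<open>R(F, F \<setminus> e)\<close> vertices of \<open>h\<close> therefore contains a copy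
  of \<open>F\<close> all of whose pairs are thin (\<open>thin_copy\<close>). Large and small hyperedges use this differently.

  In a large hyperedge the thin pairs meet every set of \<open>R\<close> vertices, so by an argument of Turan type
  they form a positive proportion of its pairs (\<open>hyperedge_square_le_thin_pairs\<close>). Each pair is a thin
  pair of at most \<open>|E(F)|\<close> hyperedges, so \<open>\<Sum> |h|\<^sup>2 = O(n\<^sup>2)\<close> over these hyperedges, and a weight
  \<open>w(m) \<le> \<eta> m\<^sup>2\<close> contributes only \<open>O(\<eta> n\<^sup>2)\<close>.

  It remains to show that there are \<open>o(n\<^sup>2)\<close> hyperedges of size less than a constant \<open>M\<close>
  (\<open>few_small_hyperedges\<close>). The thin pairs inside them form a graph \<open>G\<close>. A homomorphism from \<open>F\<close> to
  \<open>G\<close> that is injective and needs no hyperedge twice is a Berge copy of \<open>F\<close>. So every homomorphism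
  has a vertex whose image is one of boundedly many values determined by the images of the other
  vertices, and there are only \<open>O(n\<^bsup>v-1\<^esup>)\<close> homomorphisms, where \<open>v = |V(F)|\<close>. The graph removal lemma
  (\<open>graph_removal\<close>) gives \<open>o(n\<^sup>2)\<close> pairs of \<open>G\<close> that meet every homomorphism. Each small hyperedge
  contains a copy of \<open>F\<close> in \<open>G\<close>, hence one of these pairs, and each pair lies in boundedly many
  hyperedges.

  The removal lemma is derived from Szemeredi's regularity lemma (\<open>regularity_lemma\<close>) and a counting
  lemma (\<open>counting_lemma\<close>). Regularity of a pair of parts is expressed by the cut norm: the number
  of edges between any two subsets is predicted by the density, up to an error measured relative to
  the whole pair of parts. Partitions of the vertex set are the partitions into atoms of a finite
  family of sets, so that refining means enlarging the family, and averages over parts are handled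
  as conditional expectations on the set of ordered pairs.
\<close>

section \<open>Averages over the classes of a partition\<close>

text \<open>
  A partition of \<open>X\<close> is given by the map that sends each point to its class. Sums over classes are then
  sums over points, and a set is a union of classes iff it contains the class of each of its points.
\<close>
definition classes :: "'z set \<Rightarrow> ('z \<Rightarrow> 'z set) \<Rightarrow> bool" where
  "classes X K \<longleftrightarrow> (\<forall>z\<in>X. z \<in> K z \<and> K z \<subseteq> X \<and> (\<forall>u\<in>K z. K u = K z))"

definition cond_avg :: "('z \<Rightarrow> 'z set) \<Rightarrow> ('z \<Rightarrow> real) \<Rightarrow> 'z \<Rightarrow> real" where
  "cond_avg K f z = (\<Sum>u\<in>K z. f u) / real (card (K z))"

lemma classesD:
  assumes "classes X K" "z \<in> X"
  shows "z \<in> K z" "K z \<subseteq> X" "u \<in> K z \<Longrightarrow> K u = K z"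
  using assms unfolding classes_def by blast+

lemma cond_avg_cong: "K u = K z \<Longrightarrow> cond_avg K f u = cond_avg K f z"
  by (simp add: cond_avg_def)

text \<open>
  The conditional expectation is self-adjoint and fixes functions that are constant on classes: after
  expanding the average, the two points \<open>z\<close> and \<open>u\<close> of a class can be interchanged.
\<close>
lemma sum_cond_avg_mult:
  assumes "finite X" "classes X K" "Z \<subseteq> X"
    and Z: "\<And>z. z \<in> Z \<Longrightarrow> K z \<subseteq> Z"
    and g: "\<And>z u. z \<in> Z \<Longrightarrow> u \<in> K z \<Longrightarrow> g u = g z"
  shows "(\<Sum>z\<in>Z. cond_avg K f z * g z) = (\<Sum>z\<in>Z. f z * g z)"
proof -
  have fin: "finite Z" using assms(1,3) by (rule rev_finite_subset)
  have KZ: "z \<in> K z" "u \<in> K z \<Longrightarrow> K u = K z" if "z \<in> Z" for z u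
    using classesD[OF assms(2)] that assms(3) by blast+
  let ?t = "\<lambda>u. f u * g u / real (card (K u))"
  have "(\<Sum>z\<in>Z. cond_avg K f z * g z) = (\<Sum>z\<in>Z. \<Sum>u\<in>{u\<in>Z. u \<in> K z}. ?t u)"
  proof (rule sum.cong[OF refl])
    fix z assume z: "z \<in> Z"
    have "{u\<in>Z. u \<in> K z} = K z" using Z[OF z] by blast
    moreover have "(\<Sum>u\<in>K z. ?t u) = (\<Sum>u\<in>K z. f u * g z / real (card (K z)))"
    proof (rule sum.cong[OF refl])
      fix u assume "u \<in> K z"
      then have "K u = K z" "g u = g z" using KZ(2)[OF z] g[OF z] by blast+
      then show "?t u = f u * g z / real (card (K z))" by (simp only:)
    qed
    ultimately show "cond_avg K f z * g z = (\<Sum>u\<in>{u\<in>Z. u \<in> K z}. ?t u)"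
      by (simp add: cond_avg_def sum_distrib_right sum_divide_distrib)
  qed
  also have "\<dots> = (\<Sum>u\<in>Z. \<Sum>z\<in>{z\<in>Z. u \<in> K z}. ?t u)"
    by (rule sum.swap_restrict[OF fin fin])
  also have "\<dots> = (\<Sum>u\<in>Z. f u * g u)"
  proof (rule sum.cong[OF refl])
    fix u assume u: "u \<in> Z"
    have eq: "{z\<in>Z. u \<in> K z} = K u" using Z[OF u] KZ u by blast
    have "card (K u) > 0"
      using KZ(1)[OF u] finite_subset[OF Z[OF u] fin] by (auto simp: card_gt_0_iff)
    then show "(\<Sum>z\<in>{z\<in>Z. u \<in> K z}. ?t u) = f u * g u" unfolding eq by simp
  qed
  finally show ?thesis .
qed

lemma sum_cond_avg:
  assumes "finite X" "classes X K" "Z \<subseteq> X" "\<And>z. z \<in> Z \<Longrightarrow> K z \<subseteq> Z"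
  shows "(\<Sum>z\<in>Z. cond_avg K f z) = (\<Sum>z\<in>Z. f z)"
  using sum_cond_avg_mult[of X K Z "\<lambda>_. 1" f] assms by simp

text \<open>
  The energy of a partition is the squared norm of the conditional expectation. By Pythagoras,
  a refinement increases it by the total of \<open>q\<close>, the squared difference of the two expectations. On the
  class of a point of \<open>I\<close>, a union \<open>D\<close> of finer classes on which \<open>f\<close> deviates from its average forces
  the mean of \<open>q\<close> to be at least \<open>\<epsilon>\<^sup>2\<close>, by Cauchy-Schwarz; averaging over classes does not change the
  total of \<open>q\<close>, so it suffices to sum these means over \<open>I\<close>.
\<close>
lemma energy_increment:
  assumes fin: "finite X" and K: "classes X K" and K': "classes X K'"
    and ref: "\<And>z. z \<in> X \<Longrightarrow> K' z \<subseteq> K z"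
    and I: "I \<subseteq> X"
    and eps: "\<epsilon> \<ge> 0"
    and wit: "\<And>z. z \<in> I \<Longrightarrow> \<exists>D. D \<subseteq> K z \<and> (\<forall>u\<in>D. K' u \<subseteq> D) \<and>
           \<bar>(\<Sum>u\<in>D. f u) - cond_avg K f z * real (card D)\<bar> \<ge> \<epsilon> * real (card (K z))"
  shows "(\<Sum>z\<in>X. (cond_avg K f z)\<^sup>2) + \<epsilon>\<^sup>2 * real (card I) \<le> (\<Sum>z\<in>X. (cond_avg K' f z)\<^sup>2)"
proof -
  let ?E = "cond_avg K f" and ?E' = "cond_avg K' f"
  define q where "q z = (?E' z - ?E z)\<^sup>2" for z
  have KX: "K z \<subseteq> X" "K' z \<subseteq> X" if "z \<in> X" for z
    using classesD(2)[OF K that] classesD(2)[OF K' that] by blast+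
  have Econst: "?E u = ?E z" if "z \<in> X" "u \<in> K z" for u z
    by (rule cond_avg_cong) (rule classesD(3)[OF K that])
  have "(\<Sum>z\<in>X. ?E' z * ?E z) = (\<Sum>z\<in>X. f z * ?E z)"
    by (rule sum_cond_avg_mult[OF fin K' order_refl]) (use KX ref Econst in blast)+
  also have "\<dots> = (\<Sum>z\<in>X. ?E z * ?E z)"
    by (rule sum_cond_avg_mult[symmetric, OF fin K order_refl]) (use KX Econst in blast)+
  finally have orth: "(\<Sum>z\<in>X. ?E' z * ?E z) = (\<Sum>z\<in>X. ?E z * ?E z)" .
  have "(\<Sum>z\<in>X. q z) = (\<Sum>z\<in>X. (?E' z)\<^sup>2) - 2 * (\<Sum>z\<in>X. ?E' z * ?E z) + (\<Sum>z\<in>X. ?E z * ?E z)"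
    unfolding q_def
    by (simp add: power2_diff sum.distrib sum_subtractf sum_distrib_left mult.assoc
        power2_eq_square algebra_simps)
  then have pyth: "(\<Sum>z\<in>X. q z) = (\<Sum>z\<in>X. (?E' z)\<^sup>2) - (\<Sum>z\<in>X. (?E z)\<^sup>2)"
    by (simp add: orth power2_eq_square)
  have low: "cond_avg K q z \<ge> \<epsilon>\<^sup>2" if z: "z \<in> I" for z
  proof -
    have zX: "z \<in> X" using z I by blast
    obtain D where D: "D \<subseteq> K z" "\<And>u. u \<in> D \<Longrightarrow> K' u \<subseteq> D"
      "\<bar>(\<Sum>u\<in>D. f u) - ?E z * real (card D)\<bar> \<ge> \<epsilon> * real (card (K z))"
      using wit[OF z] by blast
    have finK: "finite (K z)" using KX(1)[OF zX] fin by (rule finite_subset)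
    have pos: "card (K z) > 0" using classesD(1)[OF K zX] finK by (auto simp: card_gt_0_iff)
    have finD: "finite D" using D(1) finK by (rule finite_subset)
    have "(\<Sum>u\<in>D. ?E' u) = (\<Sum>u\<in>D. f u)"
      by (rule sum_cond_avg[OF fin K']) (use D KX[OF zX] in blast)+
    moreover have "(\<Sum>u\<in>D. ?E u) = ?E z * real (card D)"
    proof -
      have "(\<Sum>u\<in>D. ?E u) = (\<Sum>u\<in>D. ?E z)"
        by (rule sum.cong[OF refl]) (use Econst[OF zX] D(1) in blast)
      then show ?thesis by simp
    qed
    ultimately have "\<epsilon> * real (card (K z)) \<le> \<bar>\<Sum>u\<in>D. ?E' u - ?E u\<bar>"
      using D(3) by (simp add: sum_subtractf)
    then have "(\<epsilon> * real (card (K z)))\<^sup>2 \<le> (\<Sum>u\<in>D. ?E' u - ?E u)\<^sup>2"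
      using eps by (metis abs_of_nonneg abs_le_square_iff mult_nonneg_nonneg of_nat_0_le_iff)
    also have "\<dots> \<le> real (card D) * (\<Sum>u\<in>D. q u)"
      using Cauchy_Schwarz_ineq_sum[of "\<lambda>_. 1" "\<lambda>u. ?E' u - ?E u" D] by (simp add: q_def)
    also have "\<dots> \<le> real (card (K z)) * (\<Sum>u\<in>K z. q u)"
      by (intro mult_mono sum_mono2 sum_nonneg finK D(1))
        (auto simp: q_def intro!: card_mono finK D(1))
    finally have "real (card (K z)) * (\<epsilon>\<^sup>2 * real (card (K z)))
        \<le> real (card (K z)) * (\<Sum>u\<in>K z. q u)"
      by (simp add: power2_eq_square algebra_simps)
    then have "\<epsilon>\<^sup>2 * real (card (K z)) \<le> (\<Sum>u\<in>K z. q u)"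
      using pos by simp
    then show ?thesis
      using pos by (simp add: cond_avg_def pos_le_divide_eq)
  qed
  have "\<epsilon>\<^sup>2 * real (card I) \<le> (\<Sum>z\<in>I. cond_avg K q z)"
    using sum_bounded_below[of I "\<epsilon>\<^sup>2" "cond_avg K q"] low by (simp add: mult.commute)
  also have "\<dots> \<le> (\<Sum>z\<in>X. cond_avg K q z)"
    by (rule sum_mono2[OF fin I]) (simp add: cond_avg_def q_def sum_nonneg)
  also have "\<dots> = (\<Sum>z\<in>X. q z)"
    by (rule sum_cond_avg[OF fin K order_refl]) (use KX in blast)
  finally show ?thesis using pyth by simp
qed

section \<open>Regular partitions\<close>

text \<open>
  The atoms of the family \<open>S\<close> are the parts of the vertex partition that \<open>S\<close> generates; the blocks are
  the products of two atoms and partition the ordered pairs of vertices.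
\<close>
definition atom :: "'b set \<Rightarrow> 'b set set \<Rightarrow> 'b \<Rightarrow> 'b set" where
  "atom V S x = {y\<in>V. \<forall>A\<in>S. x \<in> A \<longleftrightarrow> y \<in> A}"

definition block :: "'b set \<Rightarrow> 'b set set \<Rightarrow> 'b \<times> 'b \<Rightarrow> ('b \<times> 'b) set" where
  "block V S z = atom V S (fst z) \<times> atom V S (snd z)"

lemma atom_subset: "atom V S x \<subseteq> V"
  by (auto simp: atom_def)

lemma atom_self: "x \<in> V \<Longrightarrow> x \<in> atom V S x"
  by (simp add: atom_def)

lemma atom_eq: "y \<in> atom V S x \<Longrightarrow> atom V S y = atom V S x"
  by (auto simp: atom_def)

lemma atom_mono: "S \<subseteq> S' \<Longrightarrow> atom V S' x \<subseteq> atom V S x"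
  by (auto simp: atom_def)

lemma atom_generator: "A \<in> S \<Longrightarrow> x \<in> A \<Longrightarrow> atom V S x \<subseteq> A"
  by (auto simp: atom_def)

lemma card_atoms_le:
  assumes "finite S"
  shows "card (atom V S ` V) \<le> 2 ^ card S" "finite (atom V S ` V)"
proof -
  have sub: "atom V S ` V \<subseteq> (\<lambda>P. {y\<in>V. {A\<in>S. y \<in> A} = P}) ` Pow S"
  proof
    fix B assume "B \<in> atom V S ` V"
    then obtain x where x: "B = atom V S x" by blast
    have "B = {y\<in>V. {A\<in>S. y \<in> A} = {A\<in>S. x \<in> A}}" unfolding x atom_def by blast
    then show "B \<in> (\<lambda>P. {y\<in>V. {A\<in>S. y \<in> A} = P}) ` Pow S" by blast
  qed
  then have "card (atom V S ` V) \<le> card ((\<lambda>P. {y\<in>V. {A\<in>S. y \<in> A} = P}) ` Pow S)"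
    and "finite (atom V S ` V)"
    using card_mono[OF _ sub] finite_subset[OF sub] assms by simp_all
  moreover have "card ((\<lambda>P. {y\<in>V. {A\<in>S. y \<in> A} = P}) ` Pow S) \<le> 2 ^ card S"
    using card_image_le[of "Pow S"] assms by (simp add: card_Pow)
  ultimately show "card (atom V S ` V) \<le> 2 ^ card S" "finite (atom V S ` V)" by auto
qed

lemma classes_block: "classes (V \<times> V) (block V S)"
  unfolding classes_def
proof (intro ballI conjI)
  fix z assume "z \<in> V \<times> V"
  then show "z \<in> block V S z" by (auto simp: block_def atom_self)
  show "block V S z \<subseteq> V \<times> V" unfolding block_def by (intro Sigma_mono atom_subset)
  show "block V S u = block V S z" if "u \<in> block V S z" for u
    using that atom_eq[of "fst u" V S "fst z"] atom_eq[of "snd u" V S "snd z"]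
    by (simp add: block_def mem_Times_iff)
qed

lemma card_blocks_le:
  assumes "finite S"
  shows "card (block V S ` (V \<times> V)) \<le> 4 ^ card S" "finite (block V S ` (V \<times> V))"
proof -
  let ?At = "atom V S ` V"
  have sub: "block V S ` (V \<times> V) \<subseteq> (\<lambda>(A, B). A \<times> B) ` (?At \<times> ?At)"
    by (force simp: block_def)
  note a = card_atoms_le[OF assms, of V]
  show "finite (block V S ` (V \<times> V))"
    using sub a(2) by (meson finite_SigmaI finite_imageI finite_subset)
  have "card (block V S ` (V \<times> V)) \<le> card (?At \<times> ?At)"
    using surj_card_le[OF _ sub] a(2) by auto
  also have "\<dots> \<le> 2 ^ card S * 2 ^ card S"
    unfolding card_cartesian_product by (rule mult_mono) (use a(1) in auto)
  also have "\<dots> = 4 ^ card S" by (simp flip: power_mult_distrib)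
  finally show "card (block V S ` (V \<times> V)) \<le> 4 ^ card S" .
qed

text \<open>
  Irregularity depends on the block alone, as a set of pairs, and so do the witnesses \<open>S\<close> and \<open>T\<close>. This
  lets witnesses be chosen once per block.
\<close>
definition irregular :: "real \<Rightarrow> ('b \<times> 'b \<Rightarrow> real) \<Rightarrow> ('b \<times> 'b) set \<Rightarrow> bool" where
  "irregular \<epsilon> f B \<longleftrightarrow> (\<exists>S T. S \<times> T \<subseteq> B \<and>
     \<bar>(\<Sum>z\<in>S \<times> T. f z) - (\<Sum>z\<in>B. f z) / real (card B) * real (card (S \<times> T))\<bar>
        > \<epsilon> * real (card B))"

text \<open>
  Adding to the family the two witnesses of every irregular block makes each product of witnesses
  a union of blocks, as required by \<open>energy_increment\<close>. There are at most \<open>4\<^bsup>|S|\<^esup>\<close> blocks, which bounds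
  the new family by a function of the size of the old one.
\<close>
lemma refinement_increases_energy:
  fixes f :: "'b \<times> 'b \<Rightarrow> real"
  assumes V: "finite V" and S: "finite S" and eps: "\<epsilon> > 0"
  defines "I \<equiv> {z\<in>V \<times> V. irregular \<epsilon> f (block V S z)}"
  shows "\<exists>S'. finite S' \<and> card S' \<le> card S + 2 * 4 ^ card S \<and>
     (\<Sum>z\<in>V \<times> V. (cond_avg (block V S) f z)\<^sup>2) + \<epsilon>\<^sup>2 * real (card I)
       \<le> (\<Sum>z\<in>V \<times> V. (cond_avg (block V S') f z)\<^sup>2)"
proof -
  define wit where "wit B P Q \<longleftrightarrow> P \<times> Q \<subseteq> B \<and>
     \<bar>(\<Sum>z\<in>P \<times> Q. f z) - (\<Sum>z\<in>B. f z) / real (card B) * real (card (P \<times> Q))\<bar>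
        > \<epsilon> * real (card B)" for B P Q
  have "\<forall>B. \<exists>PQ. irregular \<epsilon> f B \<longrightarrow> wit B (fst PQ) (snd PQ)"
    unfolding irregular_def wit_def by simp
  then obtain PQ where PQ: "wit B (fst (PQ B)) (snd (PQ B))" if "irregular \<epsilon> f B" for B
    by metis
  define p q where "p B = fst (PQ B)" and "q B = snd (PQ B)" for B
  have pq: "wit B (p B) (q B)" if "irregular \<epsilon> f B" for B
    using PQ[OF that] by (simp add: p_def q_def)
  define Bs where "Bs = block V S ` (V \<times> V)"
  define S' where "S' = S \<union> (p ` Bs \<union> q ` Bs)"
  have Bs: "finite Bs" "card Bs \<le> 4 ^ card S"
    using card_blocks_le[OF S, of V] by (auto simp: Bs_def)
  have "card S' \<le> card S + (card (p ` Bs) + card (q ` Bs))"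
    unfolding S'_def by (meson add_left_mono card_Un_le le_trans)
  also have "\<dots> \<le> card S + 2 * 4 ^ card S"
    using Bs card_image_le[of Bs p] card_image_le[of Bs q] by linarith
  finally have cS': "card S' \<le> card S + 2 * 4 ^ card S" .
  have fS': "finite S'" using S Bs by (simp add: S'_def)
  have "(\<Sum>z\<in>V \<times> V. (cond_avg (block V S) f z)\<^sup>2) + \<epsilon>\<^sup>2 * real (card I)
       \<le> (\<Sum>z\<in>V \<times> V. (cond_avg (block V S') f z)\<^sup>2)"
  proof (rule energy_increment[OF _ classes_block classes_block])
    show "finite (V \<times> V)" using V by simp
    show "block V S' z \<subseteq> block V S z" for z
      unfolding block_def using atom_mono[of S S' V] by (auto simp: S'_def)
    show "I \<subseteq> V \<times> V" by (auto simp: I_def)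
    show "\<epsilon> \<ge> 0" using eps by simp
    fix z assume z: "z \<in> I"
    let ?B = "block V S z" let ?D = "p ?B \<times> q ?B"
    have w: "wit ?B (p ?B) (q ?B)" using z by (intro pq) (simp add: I_def)
    have mem: "p ?B \<in> S'" "q ?B \<in> S'" using z by (auto simp: S'_def Bs_def I_def)
    have "block V S' u \<subseteq> ?D" if "u \<in> ?D" for u
      using that atom_generator[OF mem(1), of "fst u" V] atom_generator[OF mem(2), of "snd u" V]
      unfolding block_def by auto
    then show "\<exists>D. D \<subseteq> ?B \<and> (\<forall>u\<in>D. block V S' u \<subseteq> D) \<and>
      \<bar>(\<Sum>u\<in>D. f u) - cond_avg (block V S) f z * real (card D)\<bar> \<ge> \<epsilon> * real (card ?B)"
      using w unfolding wit_def cond_avg_def by (intro exI[of _ ?D]) auto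
  qed
  then show ?thesis using fS' cS' by (intro exI[of _ S'] conjI)
qed

lemma cond_avg_bounds:
  assumes "\<And>u. 0 \<le> f u" "\<And>u. f u \<le> 1"
  shows "0 \<le> cond_avg K f z" "cond_avg K f z \<le> 1"
proof -
  show "0 \<le> cond_avg K f z" using assms by (simp add: cond_avg_def sum_nonneg)
  have "(\<Sum>u\<in>K z. f u) \<le> real (card (K z))"
    using sum_bounded_above[of "K z" f 1] assms by simp
  then show "cond_avg K f z \<le> 1"
    unfolding cond_avg_def by (cases "card (K z) = 0") (auto simp: divide_le_eq_1)
qed

text \<open>
  As long as more than \<open>\<epsilon> n\<^sup>2\<close> pairs lie in irregular blocks, a refinement gains energy \<open>\<epsilon>\<^sup>3 n\<^sup>2\<close>. The energy
  never exceeds \<open>n\<^sup>2\<close>, so any number of refinements above \<open>1 / \<epsilon>\<^sup>3\<close> suffices, whatever \<open>V\<close> and \<open>f\<close> are.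
\<close>
lemma regularity_lemma:
  fixes \<epsilon> :: real
  assumes eps: "\<epsilon> > 0"
  shows "\<exists>b::nat. \<forall>(V :: 'b set) f. finite V \<and> (\<forall>z. 0 \<le> f z \<and> f z \<le> 1) \<longrightarrow>
    (\<exists>S. finite S \<and> card S \<le> b \<and>
       real (card {z\<in>V \<times> V. irregular \<epsilon> f (block V S z)}) \<le> \<epsilon> * (real (card V))\<^sup>2)"
proof -
  \<comment> \<open>\<open>\<beta> t\<close> bounds the size of the family after \<open>t\<close> refinements.\<close>
  define \<beta> :: "nat \<Rightarrow> nat" where "\<beta> t = ((\<lambda>s. s + 2 * 4 ^ s) ^^ t) 0" for t
  have \<beta>: "\<beta> 0 = 0" "\<beta> (Suc t) = \<beta> t + 2 * 4 ^ \<beta> t" for t by (simp_all add: \<beta>_def)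
  have step: "\<exists>S. finite S \<and> card S \<le> \<beta> t \<and>
       (real (card {z\<in>V \<times> V. irregular \<epsilon> f (block V S z)}) \<le> \<epsilon> * (real (card V))\<^sup>2 \<or>
        real t * \<epsilon>^3 * (real (card V))\<^sup>2 \<le> (\<Sum>z\<in>V \<times> V. (cond_avg (block V S) f z)\<^sup>2))"
    if V: "finite V" for t and V :: "'b set" and f
  proof (induction t)
    case 0
    then show ?case by (intro exI[of _ "{}"]) (simp add: sum_nonneg)
  next
    case (Suc t)
    define irr where "irr S = real (card {z\<in>V \<times> V. irregular \<epsilon> f (block V S z)})" for S
    define en where "en S = (\<Sum>z\<in>V \<times> V. (cond_avg (block V S) f z)\<^sup>2)" for S
    define N where "N = (real (card V))\<^sup>2"
    note defs = irr_def[symmetric] en_def[symmetric] N_def[symmetric]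
    obtain S where S: "finite S" "card S \<le> \<beta> t" "irr S \<le> \<epsilon> * N \<or> real t * \<epsilon>^3 * N \<le> en S"
      using Suc unfolding defs by blast
    show ?case unfolding defs
    proof (cases "irr S \<le> \<epsilon> * N")
      case True
      then show "\<exists>S. finite S \<and> card S \<le> \<beta> (Suc t) \<and>
          (irr S \<le> \<epsilon> * N \<or> real (Suc t) * \<epsilon>^3 * N \<le> en S)"
        using S by (intro exI[of _ S]) (simp add: \<beta>)
    next
      case False
      then have en: "real t * \<epsilon>^3 * N \<le> en S" using S(3) by blast
      obtain S' where S': "finite S'" "card S' \<le> card S + 2 * 4 ^ card S"
        "en S + \<epsilon>\<^sup>2 * irr S \<le> en S'"
        using refinement_increases_energy[OF V S(1) eps, of f] unfolding defs by blast
      have "\<epsilon>\<^sup>2 * (\<epsilon> * N) \<le> \<epsilon>\<^sup>2 * irr S"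
        using False by (intro mult_left_mono) auto
      then have "real (Suc t) * \<epsilon>^3 * N \<le> en S'"
        using S'(3) en by (simp add: algebra_simps power2_eq_square power3_eq_cube)
      moreover have "card S' \<le> \<beta> (Suc t)"
      proof -
        have "(4::nat) ^ card S \<le> 4 ^ \<beta> t" using S(2) by (simp add: power_increasing)
        then show ?thesis using S'(2) S(2) unfolding \<beta> by linarith
      qed
      ultimately show "\<exists>S. finite S \<and> card S \<le> \<beta> (Suc t) \<and>
          (irr S \<le> \<epsilon> * N \<or> real (Suc t) * \<epsilon>^3 * N \<le> en S)"
        using S'(1) by blast
    qed
  qed
  obtain t :: nat where t: "real t > 1 / \<epsilon>^3" using reals_Archimedean2 by blast
  then have t1: "real t * \<epsilon>^3 > 1" using eps by (simp add: divide_less_eq)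
  have main: "\<exists>S. finite S \<and> card S \<le> \<beta> t \<and>
       real (card {z\<in>V \<times> V. irregular \<epsilon> f (block V S z)}) \<le> \<epsilon> * (real (card V))\<^sup>2"
    if V: "finite V" and f: "\<And>z. 0 \<le> f z \<and> f z \<le> 1" for V :: "'b set" and f
  proof (cases "V = {}")
    case True
    then show ?thesis by (intro exI[of _ "{}"]) simp
  next
    case False
    then have n: "(real (card V))\<^sup>2 > 0" using V by (simp add: card_gt_0_iff)
    have energy_le: "(\<Sum>z\<in>V \<times> V. (cond_avg (block V S) f z)\<^sup>2) \<le> (real (card V))\<^sup>2" for S
    proof -
      have "(\<Sum>z\<in>V \<times> V. (cond_avg (block V S) f z)\<^sup>2) \<le> (\<Sum>z\<in>V \<times> V. 1)"
        by (rule sum_mono) (use cond_avg_bounds[of f] f in \<open>auto intro!: power_le_one\<close>)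
      then show ?thesis by (simp add: card_cartesian_product power2_eq_square)
    qed
    have gt: "real t * \<epsilon>^3 * (real (card V))\<^sup>2 > (real (card V))\<^sup>2"
      using mult_strict_right_mono[OF t1 n] by simp
    obtain S where S: "finite S" "card S \<le> \<beta> t"
      "real (card {z\<in>V \<times> V. irregular \<epsilon> f (block V S z)}) \<le> \<epsilon> * (real (card V))\<^sup>2 \<or>
        real t * \<epsilon>^3 * (real (card V))\<^sup>2 \<le> (\<Sum>z\<in>V \<times> V. (cond_avg (block V S) f z)\<^sup>2)"
      using step[OF V, of t f] by auto
    from S(3) have "real (card {z\<in>V \<times> V. irregular \<epsilon> f (block V S z)}) \<le> \<epsilon> * (real (card V))\<^sup>2"
      using gt energy_le[of S] by linarith
    then show ?thesis using S(1,2) by (intro exI[of _ S] conjI)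
  qed
  show ?thesis by (intro exI[of _ "\<beta> t"] allI impI main) auto
qed

section \<open>Counting homomorphisms\<close>

lemma sum_PiE_insert:
  assumes "a \<notin> I"
  shows "(\<Sum>\<phi>\<in>Pi\<^sub>E (insert a I) A. X \<phi>) = (\<Sum>g\<in>Pi\<^sub>E I A. \<Sum>x\<in>A a. X (g(a := x)))"
proof -
  have "(\<Sum>\<phi>\<in>Pi\<^sub>E (insert a I) A. X \<phi>) = (\<Sum>(x, g)\<in>A a \<times> Pi\<^sub>E I A. X (g(a := x)))"
    unfolding PiE_insert_eq
    by (subst sum.reindex[OF inj_combinator[OF assms]]) (simp add: case_prod_unfold)
  also have "\<dots> = (\<Sum>x\<in>A a. \<Sum>g\<in>Pi\<^sub>E I A. X (g(a := x)))"
    by (rule sum.cartesian_product[symmetric])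
  also have "\<dots> = (\<Sum>g\<in>Pi\<^sub>E I A. \<Sum>x\<in>A a. X (g(a := x)))"
    by (rule sum.swap)
  finally show ?thesis .
qed

text \<open>
  In the cut norm on \<open>A \<times> B\<close>, the edge set \<open>G\<close> is \<open>\<epsilon>\<close>-close to the constant \<open>d\<close>.
\<close>
definition cut_close :: "real \<Rightarrow> 'b set set \<Rightarrow> 'b set \<Rightarrow> 'b set \<Rightarrow> real \<Rightarrow> bool" where
  "cut_close \<epsilon> G A B d \<longleftrightarrow> (\<forall>S T. S \<subseteq> A \<longrightarrow> T \<subseteq> B \<longrightarrow>
     \<bar>(\<Sum>z\<in>S \<times> T. of_bool ({fst z, snd z} \<in> G)) - d * real (card (S \<times> T))\<bar>
       \<le> \<epsilon> * real (card (A \<times> B)))"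

text \<open>
  Once the images of all vertices except \<open>a\<close> and \<open>b\<close> are chosen, no other edge contains both \<open>a\<close> and \<open>b\<close>, so
  the conditions imposed by the other edges separate into a condition \<open>x \<in> S\<close> on the image of \<open>a\<close> and
  a condition \<open>y \<in> T\<close> on the image of \<open>b\<close>. What remains is a sum over \<open>S \<times> T\<close>, which the cut norm bounds.
\<close>
lemma replace_edge_by_density:
  assumes I: "finite I" and A: "\<And>i. i \<in> I \<Longrightarrow> finite (A i)"
    and ab: "a \<in> I" "b \<in> I" "a \<noteq> b"
    and E: "\<And>e. e \<in> E \<Longrightarrow> card e = 2" "{a, b} \<notin> E"
    and cl: "cut_close \<epsilon> G (A a) (A b) d"
  shows "\<bar>\<Sum>\<phi>\<in>Pi\<^sub>E I A. (of_bool (\<phi> ` {a, b} \<in> G) - d) * of_bool (\<forall>e\<in>E. \<phi> ` e \<in> G)\<bar>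
     \<le> \<epsilon> * (\<Prod>i\<in>I. real (card (A i)))"
proof -
  define J where "J = I - {a, b}"
  have J: "I = insert a (insert b J)" "a \<notin> insert b J" "b \<notin> J" "finite J"
    using ab I by (auto simp: J_def)
  let ?X = "\<lambda>\<phi>. (of_bool (\<phi> ` {a, b} \<in> G) - d) * of_bool (\<forall>e\<in>E. \<phi> ` e \<in> G)"
  have inner: "\<bar>\<Sum>y\<in>A b. \<Sum>x\<in>A a. ?X (g(b := y, a := x))\<bar>
      \<le> \<epsilon> * (real (card (A a)) * real (card (A b)))" for g
  proof -
    define S where "S = {x\<in>A a. \<forall>e\<in>E. a \<in> e \<longrightarrow> (g(a := x)) ` e \<in> G}"
    define T where "T = {y\<in>A b. \<forall>e\<in>E. a \<notin> e \<longrightarrow> (g(b := y)) ` e \<in> G}"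
    have fin: "finite (A a)" "finite (A b)" using A ab by auto
    have X: "?X (g(b := y, a := x)) =
        (if x \<in> S \<and> y \<in> T then of_bool ({x, y} \<in> G) - d else 0)"
      if "x \<in> A a" "y \<in> A b" for x y
    proof -
      let ?h = "g(b := y, a := x)"
      have one: "?h ` e = (g(a := x)) ` e" if e: "e \<in> E" "a \<in> e" for e
      proof -
        have "b \<notin> e"
        proof
          assume "b \<in> e"
          then have "{a, b} \<subseteq> e" "card {a, b} = card e" "finite e"
            using e E(1)[OF e(1)] ab(3) card.infinite[of e] by auto
          then have "{a, b} = e" by (metis card_subset_eq)
          then show False using e(1) E(2) by blast
        qed
        then show ?thesis by (intro image_cong) auto
      qed
      have two: "?h ` e = (g(b := y)) ` e" if "a \<notin> e" for e
        using that by (intro image_cong) auto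
      have "?h ` e \<in> G \<longleftrightarrow> (a \<in> e \<longrightarrow> (g(a := x)) ` e \<in> G) \<and> (a \<notin> e \<longrightarrow> (g(b := y)) ` e \<in> G)"
        if "e \<in> E" for e
        using one[OF that] two[of e] by metis
      then have "(\<forall>e\<in>E. ?h ` e \<in> G) \<longleftrightarrow> x \<in> S \<and> y \<in> T"
        using that unfolding S_def T_def mem_Collect_eq by blast
      moreover have "?h ` {a, b} = {x, y}" using ab(3) by auto
      ultimately show ?thesis by simp
    qed
    have sub: "S \<subseteq> A a" "T \<subseteq> A b" by (auto simp: S_def T_def)
    have "(\<Sum>y\<in>A b. \<Sum>x\<in>A a. ?X (g(b := y, a := x)))
        = (\<Sum>y\<in>A b. \<Sum>x\<in>A a. if x \<in> S \<and> y \<in> T then of_bool ({x, y} \<in> G) - d else 0)"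
      by (intro sum.cong refl X)
    also have "\<dots> = (\<Sum>x\<in>A a. \<Sum>y\<in>A b. if x \<in> S \<and> y \<in> T then of_bool ({x, y} \<in> G) - d else 0)"
      by (rule sum.swap)
    also have "\<dots> = (\<Sum>z\<in>A a \<times> A b.
        if z \<in> S \<times> T then of_bool ({fst z, snd z} \<in> G) - d else 0)"
      unfolding sum.cartesian_product case_prod_unfold mem_Times_iff ..
    also have "\<dots> = (\<Sum>z\<in>S \<times> T. of_bool ({fst z, snd z} \<in> G) - d)"
      by (subst sum.inter_restrict[symmetric])
        (use fin sub in \<open>auto intro!: sum.cong\<close>)
    also have "\<dots> = (\<Sum>z\<in>S \<times> T. of_bool ({fst z, snd z} \<in> G)) - d * real (card (S \<times> T))"
      by (simp add: sum_subtractf)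
    finally show ?thesis
      using cl sub unfolding cut_close_def by (simp add: card_cartesian_product)
  qed
  have "(\<Sum>\<phi>\<in>Pi\<^sub>E I A. ?X \<phi>) = (\<Sum>g\<in>Pi\<^sub>E J A. \<Sum>y\<in>A b. \<Sum>x\<in>A a. ?X (g(b := y, a := x)))"
    unfolding J(1) sum_PiE_insert[OF J(2)] sum_PiE_insert[OF J(3)] ..
  then have "\<bar>\<Sum>\<phi>\<in>Pi\<^sub>E I A. ?X \<phi>\<bar>
      \<le> (\<Sum>g\<in>Pi\<^sub>E J A. \<bar>\<Sum>y\<in>A b. \<Sum>x\<in>A a. ?X (g(b := y, a := x))\<bar>)"
    by (simp only: sum_abs)
  also have "\<dots> \<le> (\<Sum>g\<in>Pi\<^sub>E J A. \<epsilon> * (real (card (A a)) * real (card (A b))))"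
    by (intro sum_mono inner)
  also have "\<dots> = \<epsilon> * (\<Prod>i\<in>I. real (card (A i)))"
    using J unfolding J(1) by (simp add: card_PiE)
  finally show ?thesis .
qed

text \<open>
  The edges of \<open>F\<close> are replaced by their densities one after the other; each replacement costs one error
  term of \<open>replace_edge_by_density\<close>.
\<close>
lemma counting_lemma:
  fixes d :: "'a set \<Rightarrow> real"
  assumes I: "finite I" and A: "\<And>i. i \<in> I \<Longrightarrow> finite (A i)" and "finite E"
    and d: "\<And>e. e \<in> E \<Longrightarrow> 0 \<le> d e \<and> d e \<le> 1"
    and E: "\<And>e. e \<in> E \<Longrightarrow> \<exists>a b. e = {a, b} \<and> a \<in> I \<and> b \<in> I \<and> a \<noteq> b \<and>
                 cut_close \<epsilon> G (A a) (A b) (d e)"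
  shows "\<bar>(\<Sum>\<phi>\<in>Pi\<^sub>E I A. of_bool (\<forall>e\<in>E. \<phi> ` e \<in> G)) - (\<Prod>e\<in>E. d e) * (\<Prod>i\<in>I. real (card (A i)))\<bar>
     \<le> real (card E) * \<epsilon> * (\<Prod>i\<in>I. real (card (A i)))"
  using \<open>finite E\<close> d E
proof (induction E rule: finite_induct)
  case empty
  then show ?case using I by (simp add: card_PiE)
next
  case (insert e E)
  define N where "N = (\<Prod>i\<in>I. real (card (A i)))"
  define s where "s = (\<Sum>\<phi>\<in>Pi\<^sub>E I A. of_bool (\<forall>e\<in>E. \<phi> ` e \<in> G) :: real)"
  define p where "p = (\<Prod>e\<in>E. d e)"
  define \<Delta> where "\<Delta> = (\<Sum>\<phi>\<in>Pi\<^sub>E I A. (of_bool (\<phi> ` e \<in> G) - d e) * of_bool (\<forall>e\<in>E. \<phi> ` e \<in> G))"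
  have IH: "\<bar>s - p * N\<bar> \<le> real (card E) * \<epsilon> * N"
    unfolding s_def p_def N_def by (rule insert.IH) (use insert.prems in auto)
  obtain a b where ab: "e = {a, b}" "a \<in> I" "b \<in> I" "a \<noteq> b" "cut_close \<epsilon> G (A a) (A b) (d e)"
    using insert.prems(2)[of e] by auto
  have card2: "card e' = 2" if "e' \<in> E" for e'
    using insert.prems(2)[of e'] that by auto
  have \<Delta>: "\<bar>\<Delta>\<bar> \<le> \<epsilon> * N"
    unfolding \<Delta>_def N_def using replace_edge_by_density[OF I A ab(2-4) card2 _ ab(5)] insert.hyps(2)
    by (simp add: ab(1))
  have split: "(\<Sum>\<phi>\<in>Pi\<^sub>E I A. of_bool (\<forall>e'\<in>insert e E. \<phi> ` e' \<in> G)) = \<Delta> + d e * s"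
    unfolding \<Delta>_def s_def sum_distrib_left sum.distrib[symmetric]
    by (intro sum.cong refl) (simp add: algebra_simps)
  have de: "0 \<le> d e" "d e \<le> 1" using insert.prems(1)[of e] by auto
  have "\<bar>d e * (s - p * N)\<bar> \<le> \<bar>s - p * N\<bar>"
    using de mult_right_mono[of "d e" 1 "\<bar>s - p * N\<bar>"] by (simp add: abs_mult)
  then have "\<bar>\<Delta> + d e * (s - p * N)\<bar> \<le> \<epsilon> * N + real (card E) * \<epsilon> * N"
    using \<Delta> IH by linarith
  moreover have "\<Delta> + d e * s - d e * p * N = \<Delta> + d e * (s - p * N)"
    by (simp add: algebra_simps)
  ultimately have "\<bar>\<Delta> + d e * s - d e * p * N\<bar> \<le> real (card (insert e E)) * \<epsilon> * N"
    using insert.hyps by (simp add: algebra_simps)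
  then show ?case using insert.hyps unfolding split by (simp add: p_def N_def)
qed

section \<open>Removing all homomorphisms\<close>

definition homs :: "'a hypergraph \<Rightarrow> 'b set \<Rightarrow> 'b set set \<Rightarrow> ('a \<Rightarrow> 'b) set" where
  "homs F V G = {\<phi> \<in> verts F \<rightarrow>\<^sub>E V. \<forall>e\<in>edges F. \<phi> ` e \<in> G}"

lemma is_graphD:
  assumes "is_graph F"
  shows "finite (verts F)" "finite (edges F)"
    and "e \<in> edges F \<Longrightarrow> e \<subseteq> verts F" "e \<in> edges F \<Longrightarrow> card e = 2"
proof -
  show 1: "finite (verts F)" "\<And>e. e \<in> edges F \<Longrightarrow> e \<subseteq> verts F"
    "\<And>e. e \<in> edges F \<Longrightarrow> card e = 2"
    using assms by (auto simp: is_graph_def is_hypergraph_def)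
  have "edges F \<subseteq> Pow (verts F)" using 1(2) by blast
  then show "finite (edges F)" using 1(1) by (meson finite_Pow_iff finite_subset)
qed

lemma card_small_atoms_le:
  assumes V: "finite V" and S: "finite S" and r: "r \<ge> 0"
  shows "real (card {x\<in>V. real (card (atom V S x)) < r}) \<le> 2 ^ card S * r"
proof -
  let ?As = "{A \<in> atom V S ` V. real (card A) < r}"
  note at = card_atoms_le[OF S, of V]
  have fin: "finite ?As" using at(2) by simp
  have "{x\<in>V. real (card (atom V S x)) < r} \<subseteq> \<Union> ?As"
    using atom_self by fastforce
  moreover have "finite (\<Union> ?As)"
    using V atom_subset[of V S] by (auto intro: finite_subset)
  ultimately have "card {x\<in>V. real (card (atom V S x)) < r} \<le> card (\<Union> ?As)"
    by (intro card_mono)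
  also have "\<dots> \<le> (\<Sum>A\<in>?As. card A)" by (rule card_Union_le_sum_card)
  finally have "real (card {x\<in>V. real (card (atom V S x)) < r}) \<le> (\<Sum>A\<in>?As. real (card A))"
    by (simp flip: of_nat_sum)
  also have "\<dots> \<le> real (card ?As) * r"
    using sum_bounded_above[of ?As "\<lambda>A. real (card A)" r] by auto
  also have "\<dots> \<le> 2 ^ card S * r"
  proof (rule mult_right_mono[OF _ r])
    have "card ?As \<le> card (atom V S ` V)" using at(2) by (intro card_mono) auto
    then have "card ?As \<le> 2 ^ card S" using at(1) by linarith
    then show "real (card ?As) \<le> 2 ^ card S" by (metis of_nat_le_iff of_nat_power of_nat_numeral)
  qed
  finally show ?thesis .
qed

lemma cut_close_of_regular:
  assumes "\<not> irregular \<epsilon> (\<lambda>z. of_bool ({fst z, snd z} \<in> G)) (block V S z)"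
  shows "cut_close \<epsilon> G (atom V S (fst z)) (atom V S (snd z))
           (cond_avg (block V S) (\<lambda>z. of_bool ({fst z, snd z} \<in> G)) z)"
  unfolding cut_close_def
proof (intro allI impI)
  fix P Q assume "P \<subseteq> atom V S (fst z)" "Q \<subseteq> atom V S (snd z)"
  then have "P \<times> Q \<subseteq> block V S z" unfolding block_def by (rule Sigma_mono)
  then show "\<bar>(\<Sum>z\<in>P \<times> Q. of_bool ({fst z, snd z} \<in> G))
       - cond_avg (block V S) (\<lambda>z. of_bool ({fst z, snd z} \<in> G)) z * real (card (P \<times> Q))\<bar>
     \<le> \<epsilon> * real (card (atom V S (fst z) \<times> atom V S (snd z)))"
    using assms unfolding irregular_def cond_avg_def block_def[symmetric] by (meson not_less)
qed

text \<open>
  The pairs in blocks of density less than \<open>r\<close> form a union of blocks, on which the number of edges equals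
  the sum of the densities.
\<close>
lemma card_low_density_edges_le:
  fixes V :: "'b set" and G :: "'b set set"
  assumes V: "finite V" and r: "r \<ge> 0"
  defines "f \<equiv> \<lambda>z::'b \<times> 'b. of_bool ({fst z, snd z} \<in> G) :: real"
  shows "real (card {z\<in>V \<times> V. {fst z, snd z} \<in> G \<and> cond_avg (block V S) f z < r})
           \<le> r * (real (card V))\<^sup>2"
proof -
  let ?Z = "{z\<in>V \<times> V. cond_avg (block V S) f z < r}"
  have fin: "finite ?Z" using V by simp
  have "real (card {z\<in>V \<times> V. {fst z, snd z} \<in> G \<and> cond_avg (block V S) f z < r})
      = real (card {z\<in>?Z. {fst z, snd z} \<in> G})"
    by (intro arg_cong[where f = "\<lambda>A. real (card A)"]) auto
  also have "\<dots> = (\<Sum>z\<in>?Z. f z)"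
    using fin unfolding f_def by (simp add: Int_def)
  also have "\<dots> = (\<Sum>z\<in>?Z. cond_avg (block V S) f z)"
  proof (rule sum_cond_avg[symmetric, OF _ classes_block])
    show "finite (V \<times> V)" using V by simp
    fix z assume z: "z \<in> ?Z"
    show "block V S z \<subseteq> ?Z"
    proof
      fix u assume u: "u \<in> block V S z"
      have zV: "z \<in> V \<times> V" using z by blast
      note c = classesD[OF classes_block[of V S] zV]
      have "cond_avg (block V S) f u = cond_avg (block V S) f z"
        by (rule cond_avg_cong) (rule c(3)[OF u])
      then show "u \<in> ?Z" using c(2) u z by auto
    qed
  qed auto
  also have "\<dots> \<le> real (card ?Z) * r"
    using sum_bounded_above[of ?Z "cond_avg (block V S) f" r] by auto
  also have "\<dots> \<le> (real (card V))\<^sup>2 * r"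
  proof (rule mult_right_mono[OF _ r])
    have "card ?Z \<le> card (V \<times> V)" using V by (intro card_mono) auto
    then have "real (card ?Z) \<le> real (card V * card V)"
      unfolding card_cartesian_product by linarith
    then show "real (card ?Z) \<le> (real (card V))\<^sup>2" by (simp add: power2_eq_square)
  qed
  finally show ?thesis by (simp add: mult.commute)
qed

text \<open>
  The removed edges \<open>B\<close> are those that lie in an irregular block, in a block of density below \<open>d0\<close>, or have
  an end in an atom with fewer than \<open>\<alpha> n\<close> vertices. If a homomorphism avoids \<open>B\<close>, then the atoms of
  its values are large, and for each edge of \<open>F\<close> the corresponding block is dense and regular. The
  counting lemma then yields at least \<open>c n\<^bsup>v\<^esup>\<close> homomorphisms.
\<close>
theorem graph_removal:
  fixes F :: "'a hypergraph" and \<delta> :: real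
  assumes F: "is_graph F" and \<delta>: "\<delta> > 0"
  shows "\<exists>c>0. \<forall>(V::'b set) G. finite V \<longrightarrow>
    real (card (homs F V G)) < c * real (card V) ^ card (verts F) \<longrightarrow>
    (\<exists>B\<subseteq>G. finite B \<and> real (card B) \<le> \<delta> * (real (card V))\<^sup>2 \<and>
       (\<forall>\<phi>\<in>homs F V G. \<exists>e\<in>edges F. \<phi> ` e \<in> B))"
proof -
  note FD = is_graphD[OF F]
  define m where "m = card (edges F)"
  define v where "v = card (verts F)"
  \<comment> \<open>Irregular and sparse edges may use up a quarter of \<open>\<delta>\<close> each, edges whose first or second
    end lies in a small atom an eighth each; \<open>\<epsilon>\<close> is also small enough for the error of the counting
    lemma to be at most half of its main term \<open>d0\<^bsup>m\<^esup>\<close>.\<close>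
  define d0 where "d0 = min 1 (\<delta> / 4)"
  have d0: "0 < d0" "d0 \<le> 1" "d0 \<le> \<delta> / 4" using \<delta> by (auto simp: d0_def)
  define \<epsilon> where "\<epsilon> = min (\<delta> / 4) (d0 ^ m / (2 * (real m + 1)))"
  have eps: "\<epsilon> \<le> \<delta> / 4" "\<epsilon> \<le> d0 ^ m / (2 * (real m + 1))"
    unfolding \<epsilon>_def by (rule min.cobounded1, rule min.cobounded2)
  have eps0: "\<epsilon> > 0" using \<delta> d0 by (simp add: \<epsilon>_def)
  have "real m * \<epsilon> \<le> real m * (d0 ^ m / (2 * (real m + 1)))"
    using eps(2) by (intro mult_left_mono) auto
  also have "\<dots> = (d0 ^ m / 2) * (real m / (real m + 1))" by (simp add: field_simps)
  also have "\<dots> \<le> (d0 ^ m / 2) * 1" using d0 by (intro mult_left_mono) auto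
  finally have m_eps: "real m * \<epsilon> \<le> d0 ^ m / 2" by simp
  obtain b where b: "\<And>(V :: 'b set) f. finite V \<Longrightarrow> (\<And>z. 0 \<le> f z \<and> f z \<le> 1) \<Longrightarrow>
    \<exists>S. finite S \<and> card S \<le> b \<and>
       real (card {z\<in>V \<times> V. irregular \<epsilon> f (block V S z)}) \<le> \<epsilon> * (real (card V))\<^sup>2"
    using regularity_lemma[OF eps0, where 'b = 'b] by meson
  define \<alpha> where "\<alpha> = min 1 (\<delta> / (8 * 2 ^ b))"
  have \<alpha>: "0 < \<alpha>" "\<alpha> \<le> 1" "2 ^ b * \<alpha> \<le> \<delta> / 8"
  proof -
    show "0 < \<alpha>" "\<alpha> \<le> 1" using \<delta> by (auto simp: \<alpha>_def)
    have "2 ^ b * \<alpha> \<le> 2 ^ b * (\<delta> / (8 * 2 ^ b))" by (intro mult_left_mono) (auto simp: \<alpha>_def)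
    then show "2 ^ b * \<alpha> \<le> \<delta> / 8" by simp
  qed
  define c where "c = d0 ^ m / 2 * \<alpha> ^ v"
  have c: "c > 0" using d0 \<alpha> by (simp add: c_def)
  have "\<exists>B\<subseteq>G. finite B \<and> real (card B) \<le> \<delta> * (real (card V))\<^sup>2 \<and>
       (\<forall>\<phi>\<in>homs F V G. \<exists>e\<in>edges F. \<phi> ` e \<in> B)"
    if V: "finite V" and few: "real (card (homs F V G)) < c * real (card V) ^ card (verts F)"
    for V :: "'b set" and G
  proof -
    define n where "n = real (card V)"
    have n0: "n \<ge> 0" by (simp add: n_def)
    define f where "f z = (of_bool ({fst z, snd z} \<in> G) :: real)" for z
    obtain S where S: "finite S" "card S \<le> b"
      and irr: "real (card {z\<in>V \<times> V. irregular \<epsilon> f (block V S z)}) \<le> \<epsilon> * n\<^sup>2"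
      using b[OF V, of f] by (auto simp: f_def n_def)
    define small where "small = {x\<in>V. real (card (atom V S x)) < \<alpha> * n}"
    define dens where "dens = cond_avg (block V S) f"
    define Irr where "Irr = {z\<in>V \<times> V. irregular \<epsilon> f (block V S z)}"
    define Low where "Low = {z\<in>V \<times> V. {fst z, snd z} \<in> G \<and> dens z < d0}"
    define Bad where "Bad = {z\<in>V \<times> V. {fst z, snd z} \<in> G \<and>
        (z \<in> Irr \<or> z \<in> Low \<or> fst z \<in> small \<or> snd z \<in> small)}"
    define B where "B = (\<lambda>z. {fst z, snd z}) ` Bad"
    have finBad: "finite Bad" using V by (simp add: Bad_def)
    have small: "real (card small) \<le> \<delta> / 8 * n"
    proof -
      have "real (card small) \<le> 2 ^ card S * (\<alpha> * n)"
        unfolding small_def using \<alpha> n0 by (intro card_small_atoms_le[OF V S(1)]) simp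
      also have "\<dots> \<le> 2 ^ b * (\<alpha> * n)"
        using S(2) \<alpha> n0 by (intro mult_right_mono power_increasing) auto
      also have "\<dots> = 2 ^ b * \<alpha> * n" by simp
      also have "\<dots> \<le> \<delta> / 8 * n" using \<alpha>(3) n0 by (rule mult_right_mono)
      finally show ?thesis .
    qed
    have fs: "finite small" using V by (simp add: small_def)
    have low: "real (card Low) \<le> d0 * n\<^sup>2"
      unfolding Low_def dens_def n_def f_def using d0 by (intro card_low_density_edges_le[OF V]) simp
    have "real (card Bad) \<le> \<delta> * n\<^sup>2"
    proof -
      have "Bad \<subseteq> Irr \<union> Low \<union> small \<times> V \<union> V \<times> small"
        by (auto simp: Bad_def)
      moreover have "finite (Irr \<union> Low \<union> small \<times> V \<union> V \<times> small)"
        using V fs by (simp add: Irr_def Low_def)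
      ultimately have "card Bad \<le> card (Irr \<union> Low \<union> small \<times> V \<union> V \<times> small)"
        by (rule card_mono[rotated])
      also have "\<dots> \<le> card Irr + card Low + card (small \<times> V) + card (V \<times> small)"
        using card_Un_le[of "Irr \<union> Low \<union> small \<times> V" "V \<times> small"]
          card_Un_le[of "Irr \<union> Low" "small \<times> V"] card_Un_le[of Irr Low] by linarith
      finally have "card Bad \<le> card Irr + card Low + card (small \<times> V) + card (V \<times> small)" .
      then have "real (card Bad) \<le> real (card Irr + card Low + card (small \<times> V) + card (V \<times> small))"
        by (rule of_nat_mono)
      also have "\<dots> = real (card Irr) + real (card Low) + 2 * (real (card small) * n)"
        by (simp add: card_cartesian_product n_def)
      also have "\<dots> \<le> \<delta> / 4 * n\<^sup>2 + \<delta> / 4 * n\<^sup>2 + 2 * (\<delta> / 8 * n * n)"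
      proof -
        have "\<epsilon> * n\<^sup>2 \<le> \<delta> / 4 * n\<^sup>2" using eps(1) by (intro mult_right_mono) auto
        moreover have "d0 * n\<^sup>2 \<le> \<delta> / 4 * n\<^sup>2" using d0(3) by (intro mult_right_mono) auto
        moreover have "real (card small) * n \<le> \<delta> / 8 * n * n"
          using small n0 by (rule mult_right_mono)
        ultimately show ?thesis using irr low unfolding Irr_def by linarith
      qed
      also have "\<dots> \<le> \<delta> * n\<^sup>2" using \<delta> by (simp add: power2_eq_square)
      finally show ?thesis .
    qed
    moreover have "card B \<le> card Bad" unfolding B_def using finBad by (rule card_image_le)
    ultimately have cardB: "real (card B) \<le> \<delta> * n\<^sup>2" by linarith
    have "\<exists>e\<in>edges F. \<phi> ` e \<in> B" if hom: "\<phi> \<in> homs F V G" for \<phi>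
    proof (rule ccontr)
      assume neg: "\<not> ?thesis"
      have \<phi>V: "\<phi> i \<in> V" if "i \<in> verts F" for i
        using hom that by (auto simp: homs_def)
      \<comment> \<open>An isolated vertex of \<open>F\<close> may be mapped anywhere; its value under \<open>\<phi>\<close> could lie in a small atom.\<close>
      define A where "A i = (if i \<in> \<Union> (edges F) then atom V S (\<phi> i) else V)" for i
      have edge: "\<exists>d. d0 \<le> d \<and> d \<le> 1 \<and> (\<exists>a b. e = {a, b} \<and> a \<in> verts F \<and> b \<in> verts F \<and> a \<noteq> b \<and>
          \<phi> a \<notin> small \<and> \<phi> b \<notin> small \<and> cut_close \<epsilon> G (A a) (A b) d)"
        if e: "e \<in> edges F" for e
      proof -
        obtain a b where ab: "e = {a, b}" "a \<noteq> b" using FD(4)[OF e] by (auto simp: card_2_iff)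
        have abF: "a \<in> verts F" "b \<in> verts F" using FD(3)[OF e] ab by auto
        let ?z = "(\<phi> a, \<phi> b)"
        have "\<phi> ` e \<in> G" using hom e by (simp add: homs_def)
        then have z: "?z \<in> V \<times> V" "{fst ?z, snd ?z} \<in> G" using abF \<phi>V ab by auto
        have eq: "{fst ?z, snd ?z} = \<phi> ` e" by (simp add: ab)
        have "?z \<notin> Bad"
        proof
          assume "?z \<in> Bad"
          then have "{fst ?z, snd ?z} \<in> B" unfolding B_def by (rule imageI)
          then show False using neg e unfolding eq by blast
        qed
        then have good: "?z \<notin> Irr" "?z \<notin> Low" "\<phi> a \<notin> small" "\<phi> b \<notin> small"
          using z by (auto simp: Bad_def)
        have "\<not> irregular \<epsilon> f (block V S ?z)" using good(1) z(1) by (simp add: Irr_def)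
        then have "cut_close \<epsilon> G (atom V S (fst ?z)) (atom V S (snd ?z)) (dens ?z)"
          unfolding dens_def f_def by (rule cut_close_of_regular)
        moreover have "A a = atom V S (fst ?z)" "A b = atom V S (snd ?z)"
          using e by (auto simp: A_def ab)
        moreover have "d0 \<le> dens ?z" using good(2) z by (simp add: Low_def)
        moreover have "dens ?z \<le> 1"
          unfolding dens_def by (rule cond_avg_bounds) (auto simp: f_def)
        ultimately show ?thesis
          using ab abF good by (intro exI[of _ "dens ?z"] conjI exI[of _ a] exI[of _ b]) simp_all
      qed
      obtain d where d: "\<And>e. e \<in> edges F \<Longrightarrow> d0 \<le> d e \<and> d e \<le> 1 \<and>
          (\<exists>a b. e = {a, b} \<and> a \<in> verts F \<and> b \<in> verts F \<and> a \<noteq> b \<and>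
          \<phi> a \<notin> small \<and> \<phi> b \<notin> small \<and> cut_close \<epsilon> G (A a) (A b) (d e))"
        using edge by metis
      define N where "N = (\<Prod>i\<in>verts F. real (card (A i)))"
      have finA: "finite (A i)" for i
        using V atom_subset[of V S "\<phi> i"] by (auto simp: A_def intro: finite_subset)
      have "\<bar>(\<Sum>\<phi>\<in>Pi\<^sub>E (verts F) A. of_bool (\<forall>e\<in>edges F. \<phi> ` e \<in> G)) - (\<Prod>e\<in>edges F. d e) * N\<bar>
          \<le> real m * \<epsilon> * N"
        unfolding m_def N_def
      proof (rule counting_lemma[OF FD(1) finA FD(2)])
        show "0 \<le> d e \<and> d e \<le> 1" if "e \<in> edges F" for e using d[OF that] d0 by linarith
        show "\<exists>a b. e = {a, b} \<and> a \<in> verts F \<and> b \<in> verts F \<and> a \<noteq> b \<and>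
                 cut_close \<epsilon> G (A a) (A b) (d e)" if "e \<in> edges F" for e
          using d[OF that] by blast
      qed
      moreover have "(\<Sum>\<phi>\<in>Pi\<^sub>E (verts F) A. of_bool (\<forall>e\<in>edges F. \<phi> ` e \<in> G))
          \<le> real (card (homs F V G))"
      proof -
        have fP: "finite (Pi\<^sub>E (verts F) A)" using FD(1) finA by (rule finite_PiE)
        have "(\<Sum>\<phi>\<in>Pi\<^sub>E (verts F) A. of_bool (\<forall>e\<in>edges F. \<phi> ` e \<in> G))
            = real (card {\<phi>\<in>Pi\<^sub>E (verts F) A. \<forall>e\<in>edges F. \<phi> ` e \<in> G})"
          using fP by (simp add: Int_def)
        also have "{\<phi>\<in>Pi\<^sub>E (verts F) A. \<forall>e\<in>edges F. \<phi> ` e \<in> G} \<subseteq> homs F V G"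
        proof -
          have "A i \<subseteq> V" for i using atom_subset[of V S] by (auto simp: A_def)
          then have "Pi\<^sub>E (verts F) A \<subseteq> verts F \<rightarrow>\<^sub>E V" by (intro PiE_mono)
          then show ?thesis unfolding homs_def by blast
        qed
        then have "real (card {\<phi>\<in>Pi\<^sub>E (verts F) A. \<forall>e\<in>edges F. \<phi> ` e \<in> G}) \<le> real (card (homs F V G))"
          using V FD(1) by (intro of_nat_mono card_mono) (auto simp: homs_def intro!: finite_PiE)
        finally show ?thesis .
      qed
      ultimately have upper: "(\<Prod>e\<in>edges F. d e) * N - real m * \<epsilon> * N \<le> real (card (homs F V G))"
        by linarith
      have "d0 ^ m = (\<Prod>e\<in>edges F. d0)" by (simp add: m_def)
      also have "\<dots> \<le> (\<Prod>e\<in>edges F. d e)" using d d0 by (intro prod_mono) auto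
      finally have lo: "d0 ^ m / 2 \<le> (\<Prod>e\<in>edges F. d e) - real m * \<epsilon>" using m_eps by linarith
      have N: "(\<alpha> * n) ^ v \<le> N"
      proof -
        have "(\<alpha> * n) ^ v = (\<Prod>i\<in>verts F. \<alpha> * n)" by (simp add: v_def)
        also have "\<dots> \<le> N" unfolding N_def
        proof (rule prod_mono)
          fix i assume i: "i \<in> verts F"
          have "\<alpha> * n \<le> real (card (A i))"
          proof (cases "i \<in> \<Union> (edges F)")
            case True
            then obtain e where e: "e \<in> edges F" "i \<in> e" by blast
            have "\<phi> i \<notin> small" using d[OF e(1)] e(2) by blast
            then show ?thesis using True \<phi>V[OF i] by (simp add: small_def A_def)
          next
            case False
            then show ?thesis using \<alpha> n0 mult_right_mono[of \<alpha> 1 n] by (simp add: A_def n_def)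
          qed
          then show "0 \<le> \<alpha> * n \<and> \<alpha> * n \<le> real (card (A i))" using \<alpha> n0 by simp
        qed
        finally show ?thesis .
      qed
      have "0 \<le> d0 ^ m / 2" using d0 by simp
      then have "0 \<le> (\<Prod>e\<in>edges F. d e) - real m * \<epsilon>" using lo by linarith
      then have "d0 ^ m / 2 * (\<alpha> * n) ^ v \<le> ((\<Prod>e\<in>edges F. d e) - real m * \<epsilon>) * N"
        using \<alpha> n0 by (intro mult_mono lo N) simp_all
      also have "\<dots> \<le> real (card (homs F V G))" using upper by (simp add: left_diff_distrib)
      finally have "c * n ^ v \<le> real (card (homs F V G))"
        by (simp add: c_def power_mult_distrib mult.assoc)
      then show False using few by (simp add: n_def v_def)
    qed
    moreover have "B \<subseteq> G" by (auto simp: B_def Bad_def)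
    moreover have "finite B" using finBad by (simp add: B_def)
    ultimately show ?thesis using cardB unfolding n_def by (intro exI[of _ B]) auto
  qed
  then show ?thesis using c by (intro exI[of _ c]) auto
qed

section \<open>Thin pairs in Berge-free hypergraphs\<close>

definition codegree :: "'b hypergraph \<Rightarrow> 'b set \<Rightarrow> nat" where
  "codegree H p = card {h\<in>edges H. p \<subseteq> h}"

lemma finite_edges: "is_hypergraph H \<Longrightarrow> finite (edges H)"
  unfolding is_hypergraph_def by (meson Pow_iff finite_Pow_iff finite_subset subsetI)

lemma finite_hyperedge: "is_hypergraph H \<Longrightarrow> h \<in> edges H \<Longrightarrow> finite h"
  unfolding is_hypergraph_def by (meson finite_subset)

text \<open>
  Greedy choice: a set with at least \<open>|J|\<close> elements has one that the other indices do not use.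
\<close>
lemma distinct_representatives:
  assumes "finite J" "\<And>j. j \<in> J \<Longrightarrow> card J \<le> card (C j)"
  shows "\<exists>f. inj_on f J \<and> (\<forall>j\<in>J. f j \<in> C j)"
  using assms
proof (induction J rule: finite_induct)
  case (insert j J)
  have "card J \<le> card (C i)" if "i \<in> J" for i
    using insert.prems[of i] insert.hyps that by simp
  then obtain f where f: "inj_on f J" "\<forall>i\<in>J. f i \<in> C i" using insert.IH by blast
  have "card (f ` J) < card (C j)"
    using insert.prems[of j] insert.hyps card_image_le[of J f] by simp
  then have "\<not> C j \<subseteq> f ` J" using insert.hyps(1) card_mono[of "f ` J" "C j"] by auto
  then obtain x where x: "x \<in> C j" "x \<notin> f ` J" by blast
  have "inj_on (f(j := x)) (insert j J)" using f(1) x(2) insert.hyps(2)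
    by (auto simp: inj_on_def)
  moreover have "\<forall>i\<in>insert j J. (f(j := x)) i \<in> C i" using f(2) x(1) by auto
  ultimately show ?case by blast
qed simp

text \<open>
  It suffices to map the edges of \<open>F\<close> injectively to hyperedges of \<open>H\<close>; the chosen hyperedges form the
  subhypergraph.
\<close>
lemma Berge_freeD:
  assumes "is_hypergraph H" "Berge_free F H"
    and "inj_on \<phi> (verts F)" "\<phi> ` verts F \<subseteq> verts H"
    and "inj_on f (edges F)" "\<And>e. e \<in> edges F \<Longrightarrow> f e \<in> edges H \<and> \<phi> ` e \<subseteq> f e"
  shows False
proof -
  let ?H' = "(verts H, f ` edges F)"
  have "subhypergraph ?H' H"
    using assms(1,6) by (auto simp: subhypergraph_def is_hypergraph_def verts_def edges_def)
  moreover have "is_Berge F ?H'"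
    unfolding is_Berge_def using assms(3-6)
    by (intro exI[of _ \<phi>] exI[of _ f]) (auto simp: bij_betw_def verts_def edges_def)
  ultimately show False using assms(2) by (auto simp: Berge_free_def)
qed

text \<open>
  Otherwise \<open>h\<close> represents \<open>e0\<close>. Each of the other \<open>|E(F)| - 1\<close> edges is contained in at least as many
  hyperedges different from \<open>h\<close>, so distinct ones can be chosen greedily.
\<close>
lemma thin_edge_besides:
  assumes F: "is_graph F" and H: "is_hypergraph H" "Berge_free F H"
    and e0: "e0 \<in> edges F" and h: "h \<in> edges H"
    and \<phi>: "inj_on \<phi> (verts F)" "\<phi> ` verts F \<subseteq> h"
  shows "\<exists>e\<in>edges F - {e0}. codegree H (\<phi> ` e) < card (edges F)"
proof (rule ccontr)
  assume "\<not> ?thesis"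
  then have thick: "card (edges F) \<le> card {h\<in>edges H. \<phi> ` e \<subseteq> h}" if "e \<in> edges F - {e0}" for e
    using that unfolding codegree_def by (meson not_less)
  note FD = is_graphD[OF F]
  let ?J = "edges F - {e0}"
  have "card ?J \<le> card ({h\<in>edges H. \<phi> ` e \<subseteq> h} - {h})" if "e \<in> ?J" for e
  proof -
    have "card (edges F) - 1 \<le> card {h\<in>edges H. \<phi> ` e \<subseteq> h} - card {h}"
      using thick[OF that] by simp
    also have "\<dots> \<le> card ({h\<in>edges H. \<phi> ` e \<subseteq> h} - {h})" by (rule diff_card_le_card_Diff) simp
    finally show ?thesis using e0 by simp
  qed
  then obtain f where f: "inj_on f ?J" "\<forall>e\<in>?J. f e \<in> {h\<in>edges H. \<phi> ` e \<subseteq> h} - {h}"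
    using distinct_representatives[of ?J "\<lambda>e. {h\<in>edges H. \<phi> ` e \<subseteq> h} - {h}"] FD(2) by auto
  show False
  proof (rule Berge_freeD[OF H \<phi>(1)])
    show "\<phi> ` verts F \<subseteq> verts H" using \<phi>(2) h H(1) by (auto simp: is_hypergraph_def)
    show "inj_on (f(e0 := h)) (edges F)"
      using f by (auto simp: inj_on_def)
    show "(f(e0 := h)) e \<in> edges H \<and> \<phi> ` e \<subseteq> (f(e0 := h)) e" if "e \<in> edges F" for e
    proof (cases "e = e0")
      case True
      have "\<phi> ` e0 \<subseteq> h" using FD(3)[OF e0] \<phi>(2) by blast
      then show ?thesis using True h by simp
    next
      case False
      then show ?thesis using f(2) that by simp
    qed
  qed
qed

lemma contains_copy_clique:
  assumes G: "is_graph G" and X: "finite X" "card (verts G) \<le> card X" "X \<subseteq> V"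
    and E: "nsets X 2 \<subseteq> E"
  shows "contains_copy G (V, E)"
proof -
  note GD = is_graphD[OF G]
  obtain \<phi> where \<phi>: "\<phi> ` verts G \<subseteq> X" "inj_on \<phi> (verts G)"
    using card_le_inj[OF GD(1) X(1,2)] by blast
  have "\<phi> ` e \<in> E" if e: "e \<in> edges G" for e
  proof -
    have "inj_on \<phi> e" using \<phi>(2) GD(3)[OF e] by (rule inj_on_subset)
    then have "card (\<phi> ` e) = 2" using GD(4)[OF e] by (simp add: card_image)
    moreover have "\<phi> ` e \<subseteq> X" using \<phi>(1) GD(3)[OF e] by blast
    ultimately have "\<phi> ` e \<in> nsets X 2" using X(1) by (auto simp: nsets_def intro: finite_subset)
    then show ?thesis using E by blast
  qed
  then show ?thesis using \<phi> X(3) unfolding contains_copy_def verts_def edges_def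
    by (intro exI[of _ \<phi>]) auto
qed

text \<open>
  The least number in the definition of the Ramsey number exists by Ramsey's theorem for cliques of the
  orders of \<open>F\<close> and \<open>G\<close>, so it has the defining property.
\<close>
lemma ramsey_number_arrows:
  fixes F :: "'a hypergraph" and G :: "'b hypergraph" and c :: "nat set \<Rightarrow> bool"
  assumes F: "is_graph F" and G: "is_graph G"
  defines "R \<equiv> ramsey_number F G"
  shows "contains_copy F ({..<R}, {s \<in> nsets {..<R} 2. c s}) \<or>
         contains_copy G ({..<R}, {s \<in> nsets {..<R} 2. \<not> c s})"
proof -
  let ?P = "\<lambda>N. \<forall>c :: nat set \<Rightarrow> bool.
        contains_copy F ({..<N}, {s \<in> nsets {..<N} 2. c s}) \<or>
        contains_copy G ({..<N}, {s \<in> nsets {..<N} 2. \<not> c s})"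
  obtain N where N: "partn_lst {..<N::nat} [card (verts F), card (verts G)] 2"
    using ramsey_full by blast
  have "?P N"
  proof
    fix c :: "nat set \<Rightarrow> bool"
    let ?f = "\<lambda>s. if c s then 0 else 1 :: nat"
    have "?f \<in> nsets {..<N} 2 \<rightarrow> {..<length [card (verts F), card (verts G)]}" by auto
    then have "\<exists>i<length [card (verts F), card (verts G)].
        monochromatic {..<N} ([card (verts F), card (verts G)] ! i) 2 ?f i"
      using N unfolding partn_lst_def by (rule bspec[rotated])
    then obtain i X where i: "i < length [card (verts F), card (verts G)]"
      "X \<in> nsets {..<N} ([card (verts F), card (verts G)] ! i)" "?f ` nsets X 2 \<subseteq> {i}"
      unfolding monochromatic_def by blast
    have X: "finite X" "X \<subseteq> {..<N}" "card X = [card (verts F), card (verts G)] ! i"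
      using i(2) by (auto simp: nsets_def)
    have sub: "nsets X 2 \<subseteq> nsets {..<N} 2" by (rule nsets_mono[OF X(2)])
    have col: "?f s = i" if "s \<in> nsets X 2" for s using i(3) that by blast
    have "i < 2" using i(1) by simp
    then consider "i = 0" | "i = 1" by linarith
    then show "contains_copy F ({..<N}, {s \<in> nsets {..<N} 2. c s}) \<or>
        contains_copy G ({..<N}, {s \<in> nsets {..<N} 2. \<not> c s})"
    proof cases
      case 1
      have "c s" if "s \<in> nsets X 2" for s using col[OF that] 1 by (auto split: if_splits)
      then have "nsets X 2 \<subseteq> {s \<in> nsets {..<N} 2. c s}" using sub by blast
      moreover have "card (verts F) \<le> card X" using X(3) 1 by simp
      ultimately show ?thesis by (intro disjI1 contains_copy_clique[OF F X(1) _ X(2)])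
    next
      case 2
      have "\<not> c s" if "s \<in> nsets X 2" for s
      proof
        assume "c s"
        then have "i = 0" using col[OF that] by simp
        then show False using 2 by simp
      qed
      then have "nsets X 2 \<subseteq> {s \<in> nsets {..<N} 2. \<not> c s}" using sub by blast
      moreover have "card (verts G) \<le> card X" using X(3) 2 by simp
      ultimately show ?thesis by (intro disjI2 contains_copy_clique[OF G X(1) _ X(2)])
    qed
  qed
  then have "?P R" unfolding R_def ramsey_number_def by (rule LeastI)
  then show ?thesis by blast
qed

text \<open>
  Colour the pairs of \<open>R\<close> vertices of \<open>S\<close> thin or thick. A thick copy of \<open>F \<setminus> e0\<close> is excluded by
  \<open>thin_edge_besides\<close>, which leaves a thin copy of \<open>F\<close>.
\<close>
lemma thin_copy:
  assumes F: "is_graph F" and e0: "e0 \<in> edges F"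
    and H: "is_hypergraph H" "Berge_free F H"
    and h: "h \<in> edges H" "S \<subseteq> h" "ramsey_number F (delete_edge F e0) \<le> card S"
  shows "\<exists>\<phi>. inj_on \<phi> (verts F) \<and> \<phi> ` verts F \<subseteq> S \<and>
           (\<forall>e\<in>edges F. codegree H (\<phi> ` e) < card (edges F))"
proof -
  define R where "R = ramsey_number F (delete_edge F e0)"
  have F': "is_graph (delete_edge F e0)"
    using F by (auto simp: is_graph_def is_hypergraph_def delete_edge_def verts_def edges_def)
  have v': "verts (delete_edge F e0) = verts F" "edges (delete_edge F e0) = edges F - {e0}"
    by (simp_all add: delete_edge_def verts_def edges_def)
  have "finite S" using finite_hyperedge[OF H(1) h(1)] h(2) by (rule rev_finite_subset)
  then obtain g where g: "g ` {..<R} \<subseteq> S" "inj_on g {..<R}"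
    using card_le_inj[of "{..<R}" S] h(3) by (auto simp: R_def)
  define c where "c s \<longleftrightarrow> codegree H (g ` s) < card (edges F)" for s
  have copy: "inj_on (g \<circ> \<psi>) (verts F)" "(g \<circ> \<psi>) ` verts F \<subseteq> S"
    if "inj_on \<psi> (verts F)" "\<psi> ` verts F \<subseteq> {..<R}" for \<psi>
    using comp_inj_on[OF that(1) inj_on_subset[OF g(2) that(2)]] that(2) g(1) by auto
  from ramsey_number_arrows[OF F F', of c] show ?thesis
    unfolding R_def[symmetric]
  proof
    assume "contains_copy F ({..<R}, {s \<in> nsets {..<R} 2. c s})"
    then obtain \<psi> where \<psi>: "inj_on \<psi> (verts F)" "\<psi> ` verts F \<subseteq> {..<R}"
      "\<And>e. e \<in> edges F \<Longrightarrow> c (\<psi> ` e)"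
      unfolding contains_copy_def verts_def edges_def by auto
    then show ?thesis
      using copy[OF \<psi>(1,2)] unfolding c_def by (intro exI[of _ "g \<circ> \<psi>"]) (simp add: image_comp)
  next
    assume "contains_copy (delete_edge F e0) ({..<R}, {s \<in> nsets {..<R} 2. \<not> c s})"
    then have "\<exists>\<psi>. inj_on \<psi> (verts F) \<and> \<psi> ` verts F \<subseteq> {..<R} \<and>
        (\<forall>e\<in>edges F - {e0}. \<not> c (\<psi> ` e))"
      unfolding contains_copy_def v' by (auto simp: verts_def edges_def)
    then obtain \<psi> where \<psi>: "inj_on \<psi> (verts F)" "\<psi> ` verts F \<subseteq> {..<R}"
      "\<And>e. e \<in> edges F - {e0} \<Longrightarrow> \<not> c (\<psi> ` e)" by blast
    obtain e where "e \<in> edges F - {e0}" "codegree H ((g \<circ> \<psi>) ` e) < card (edges F)"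
      using thin_edge_besides[OF F H e0 h(1) copy(1)[OF \<psi>(1,2)]] copy(2)[OF \<psi>(1,2)] h(2) by blast
    then have False using \<psi>(3) unfolding c_def by (simp add: image_comp)
    then show ?thesis ..
  qed
qed

section \<open>Large hyperedges\<close>

text \<open>
  A weak form of Turan's theorem. A maximal independent set \<open>I\<close> has fewer than \<open>r\<close> elements, and every
  element of \<open>S\<close> is related to some element of \<open>I\<close>. This gives \<open>|S|\<close> related pairs, and the rest lie in
  \<open>S - I\<close>, to which the induction hypothesis applies.
\<close>
lemma square_le_related_pairs:
  fixes r :: nat
  assumes "finite S" and refl: "\<And>x. x \<in> S \<Longrightarrow> D x x" and sym: "\<And>x y. D x y \<Longrightarrow> D y x"
    and indep: "\<And>I. I \<subseteq> S \<Longrightarrow> r \<le> card I \<Longrightarrow> \<exists>x\<in>I. \<exists>y\<in>I. x \<noteq> y \<and> D x y"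
  shows "(card S)\<^sup>2 \<le> 2 * r * card {z\<in>S \<times> S. D (fst z) (snd z)}"
  using assms(1) refl indep
proof (induction S rule: finite_psubset_induct)
  case (psubset S)
  show ?case
  proof (cases "S = {}")
    case False
    define \<I> where "\<I> = {I. I \<subseteq> S \<and> (\<forall>x\<in>I. \<forall>y\<in>I. x \<noteq> y \<longrightarrow> \<not> D x y)}"
    have "finite \<I>" "\<I> \<noteq> {}" using psubset.hyps(1) by (auto simp: \<I>_def)
    then obtain I where I: "I \<in> \<I>" and max: "\<And>J. J \<in> \<I> \<Longrightarrow> I \<subseteq> J \<Longrightarrow> I = J"
      using finite_has_maximal[of \<I>] by blast
    have IS: "I \<subseteq> S" and ind: "\<And>x y. x \<in> I \<Longrightarrow> y \<in> I \<Longrightarrow> x \<noteq> y \<Longrightarrow> \<not> D x y"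
      using I by (auto simp: \<I>_def)
    have fI: "finite I" using IS psubset.hyps(1) by (rule finite_subset)
    have dom: "\<exists>x\<in>I. D x y" if y: "y \<in> S" for y
    proof (cases "y \<in> I")
      case True
      then show ?thesis using psubset.prems(1)[OF y] by blast
    next
      case False
      then have "insert y I \<notin> \<I>" using max[of "insert y I"] by blast
      then obtain x where "x \<in> I" "D x y \<or> D y x" using y IS ind unfolding \<I>_def by blast
      then show ?thesis using sym by blast
    qed
    have "I \<noteq> {}" using False dom by blast
    then have less: "S - I \<subset> S" using IS by blast
    have Ir: "card I < r"
    proof (rule ccontr)
      assume "\<not> card I < r"
      then have "r \<le> card I" by simp
      then obtain x y where "x \<in> I" "y \<in> I" "x \<noteq> y" "D x y"
        using psubset.prems(2)[OF IS] by blast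
      then show False using ind by blast
    qed
    let ?P = "\<lambda>S. {z\<in>S \<times> S. D (fst z) (snd z)}"
    let ?Q = "{z\<in>I \<times> S. D (fst z) (snd z)}"
    have IH: "(card (S - I))\<^sup>2 \<le> 2 * r * card (?P (S - I))"
    proof (rule psubset.IH[OF less])
      show "D x x" if "x \<in> S - I" for x using psubset.prems(1) that by blast
      show "\<exists>x\<in>J. \<exists>y\<in>J. x \<noteq> y \<and> D x y" if "J \<subseteq> S - I" "r \<le> card J" for J
        using psubset.prems(2)[of J] that by blast
    qed
    have "S \<subseteq> snd ` ?Q"
    proof
      fix y assume y: "y \<in> S"
      then obtain x where "x \<in> I" "D x y" using dom by blast
      then show "y \<in> snd ` ?Q" using y by (intro image_eqI[of _ _ "(x, y)"]) auto
    qed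
    then have "card S \<le> card (snd ` ?Q)"
      using psubset.hyps(1) fI by (intro card_mono) simp_all
    also have "\<dots> \<le> card ?Q" using psubset.hyps(1) fI by (intro card_image_le) simp
    finally have "card (?P (S - I)) + card S \<le> card (?P (S - I)) + card ?Q" by simp
    also have "\<dots> = card (?P (S - I) \<union> ?Q)"
      using psubset.hyps(1) fI by (intro card_Un_disjoint[symmetric]) auto
    also have "\<dots> \<le> card (?P S)"
      using psubset.hyps(1) IS by (intro card_mono) auto
    finally have step: "card (?P (S - I)) + card S \<le> card (?P S)" .
    have cS: "card S = card (S - I) + card I"
      using card_Diff_subset[OF fI IS] card_mono[OF psubset.hyps(1) IS] by simp
    have "(card S)\<^sup>2 = (card (S - I))\<^sup>2 + card I * (2 * card (S - I) + card I)"
      unfolding cS by (simp add: power2_eq_square algebra_simps)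
    also have "\<dots> \<le> 2 * r * card (?P (S - I)) + r * (2 * card S)"
      using IH Ir by (intro add_mono mult_mono) (auto simp: cS)
    also have "\<dots> = 2 * r * (card (?P (S - I)) + card S)" by (simp add: algebra_simps)
    also have "\<dots> \<le> 2 * r * card (?P S)" using step by (rule mult_left_mono) simp
    finally show ?thesis .
  qed simp
qed

text \<open>
  Ordered pairs, hence each thin pair is counted twice.
\<close>
definition thin_pairs :: "'b hypergraph \<Rightarrow> nat \<Rightarrow> 'b set \<Rightarrow> ('b \<times> 'b) set" where
  "thin_pairs H m h = {z\<in>h \<times> h. fst z \<noteq> snd z \<and> codegree H {fst z, snd z} < m}"

text \<open>
  Double counting: a pair that is thin in some hyperedge lies in fewer than \<open>m\<close> hyperedges.
\<close>
lemma sum_thin_pairs_le: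
  assumes H: "is_hypergraph H"
  shows "(\<Sum>h\<in>edges H. card (thin_pairs H m h)) \<le> m * (card (verts H))\<^sup>2"
proof -
  let ?V = "verts H"
  have fin: "finite (?V \<times> ?V)" using H by (simp add: is_hypergraph_def)
  have "(\<Sum>h\<in>edges H. card (thin_pairs H m h))
      = (\<Sum>h\<in>edges H. \<Sum>z\<in>{z\<in>?V \<times> ?V. z \<in> thin_pairs H m h}. 1)"
  proof (rule sum.cong[OF refl])
    fix h assume "h \<in> edges H"
    then have "{z\<in>?V \<times> ?V. z \<in> thin_pairs H m h} = thin_pairs H m h"
      using H by (auto simp: thin_pairs_def is_hypergraph_def)
    then show "card (thin_pairs H m h) = (\<Sum>z\<in>{z\<in>?V \<times> ?V. z \<in> thin_pairs H m h}. 1)" by simp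
  qed
  also have "\<dots> = (\<Sum>z\<in>?V \<times> ?V. \<Sum>h\<in>{h\<in>edges H. z \<in> thin_pairs H m h}. 1)"
    by (rule sum.swap_restrict[OF finite_edges[OF H] fin])
  also have "\<dots> \<le> (\<Sum>z\<in>?V \<times> ?V. m)"
  proof (rule sum_mono)
    fix z
    show "(\<Sum>h\<in>{h\<in>edges H. z \<in> thin_pairs H m h}. 1) \<le> m"
    proof (cases "codegree H {fst z, snd z} < m")
      case True
      have "card {h\<in>edges H. z \<in> thin_pairs H m h} \<le> codegree H {fst z, snd z}"
        unfolding codegree_def using finite_edges[OF H]
        by (intro card_mono) (auto simp: thin_pairs_def)
      then show ?thesis using True by simp
    qed (simp add: thin_pairs_def)
  qed
  also have "\<dots> = m * (card ?V)\<^sup>2"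
    by (simp add: card_cartesian_product power2_eq_square)
  finally show ?thesis .
qed

text \<open>
  By \<open>thin_copy\<close>, any \<open>R\<close> vertices of \<open>h\<close> contain a thin pair, namely the image of \<open>e0\<close>. The diagonal is
  included among the related pairs to apply \<open>square_le_related_pairs\<close>; since \<open>|h| \<ge> 4 R\<close>, its contribution
  \<open>2 R |h|\<close> is at most half of \<open>|h|\<^sup>2\<close>.
\<close>
lemma hyperedge_square_le_thin_pairs:
  assumes F: "is_graph F" and e0: "e0 \<in> edges F"
    and H: "is_hypergraph H" "Berge_free F H" and h: "h \<in> edges H"
    and big: "4 * ramsey_number F (delete_edge F e0) \<le> card h"
  shows "(card h)\<^sup>2
    \<le> 4 * ramsey_number F (delete_edge F e0) * card (thin_pairs H (card (edges F)) h)"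
proof -
  define R where "R = ramsey_number F (delete_edge F e0)"
  define m where "m = card (edges F)"
  define D where "D x y \<longleftrightarrow> x = y \<or> codegree H {x, y} < m" for x y
  note fin = finite_hyperedge[OF H(1) h]
  have "(card h)\<^sup>2 \<le> 2 * R * card {z\<in>h \<times> h. D (fst z) (snd z)}"
  proof (rule square_le_related_pairs[OF fin])
    show "D x x" for x by (simp add: D_def)
    show "D x y \<Longrightarrow> D y x" for x y by (auto simp: D_def insert_commute)
    fix I assume I: "I \<subseteq> h" "R \<le> card I"
    obtain \<phi> where \<phi>: "inj_on \<phi> (verts F)" "\<phi> ` verts F \<subseteq> I"
      "\<And>e. e \<in> edges F \<Longrightarrow> codegree H (\<phi> ` e) < m"
      using thin_copy[OF F e0 H h I(1)] I(2) unfolding R_def m_def by blast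
    obtain a b where ab: "e0 = {a, b}" "a \<noteq> b"
      using is_graphD(4)[OF F e0] by (auto simp: card_2_iff)
    have "a \<in> verts F" "b \<in> verts F" using is_graphD(3)[OF F e0] ab by auto
    then have "\<phi> a \<in> I" "\<phi> b \<in> I" "\<phi> a \<noteq> \<phi> b"
      using \<phi>(1,2) ab(2) by (auto dest: inj_onD)
    moreover have "D (\<phi> a) (\<phi> b)" using \<phi>(3)[OF e0] by (simp add: D_def ab)
    ultimately show "\<exists>x\<in>I. \<exists>y\<in>I. x \<noteq> y \<and> D x y" by blast
  qed
  also have "card {z\<in>h \<times> h. D (fst z) (snd z)} \<le> card (thin_pairs H m h \<union> (\<lambda>x. (x, x)) ` h)"
    using fin by (intro card_mono) (auto simp: thin_pairs_def D_def)
  then have "2 * R * card {z\<in>h \<times> h. D (fst z) (snd z)} \<le> 2 * R * (card (thin_pairs H m h) + card h)"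
    using card_Un_le[of "thin_pairs H m h" "(\<lambda>x. (x, x)) ` h"] card_image_le[OF fin, of "\<lambda>x. (x, x)"]
    by (intro mult_left_mono) auto
  finally have "(card h)\<^sup>2 \<le> 2 * R * card (thin_pairs H m h) + 2 * R * card h"
    by (simp add: algebra_simps)
  moreover have "2 * (2 * R * card h) \<le> (card h)\<^sup>2"
    using mult_right_mono[OF big, of "card h"] by (simp add: R_def power2_eq_square)
  ultimately show ?thesis unfolding R_def m_def by linarith
qed

section \<open>Small hyperedges\<close>

text \<open>
  A function that takes at \<open>i\<close> one of \<open>k\<close> values prescribed by its restriction to the other points is
  determined by this restriction and the index of the value.
\<close>
lemma card_determined_coordinate:
  fixes V :: "'b set"
  assumes I: "finite I" "i \<in> I" and V: "finite V"
    and N: "\<And>g. finite (N g)" "\<And>g. card (N g) \<le> k"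
    and local: "\<And>\<phi>. N (restrict \<phi> (I - {i})) = N \<phi>"
  shows "card {\<phi> \<in> I \<rightarrow>\<^sub>E V. \<phi> i \<in> N \<phi>} \<le> k * card V ^ (card I - 1)"
proof -
  let ?P = "(I - {i}) \<rightarrow>\<^sub>E V" let ?S = "SIGMA g:?P. N g"
  have fP: "finite ?P" using I V by (intro finite_PiE) auto
  have "{\<phi> \<in> I \<rightarrow>\<^sub>E V. \<phi> i \<in> N \<phi>} \<subseteq> (\<lambda>(g, x). g(i := x)) ` ?S"
  proof
    fix \<phi> assume \<phi>: "\<phi> \<in> {\<phi> \<in> I \<rightarrow>\<^sub>E V. \<phi> i \<in> N \<phi>}"
    let ?g = "restrict \<phi> (I - {i})"
    have "?g \<in> ?P" using \<phi> by auto
    moreover have "\<phi> i \<in> N ?g" using \<phi> local by simp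
    moreover have "\<phi> = ?g(i := \<phi> i)"
      using \<phi> by (auto simp: fun_eq_iff PiE_iff extensional_def)
    ultimately show "\<phi> \<in> (\<lambda>(g, x). g(i := x)) ` ?S"
      by (intro image_eqI[of _ _ "(?g, \<phi> i)"]) auto
  qed
  moreover have "finite ?S" using fP N(1) by auto
  ultimately have "card {\<phi> \<in> I \<rightarrow>\<^sub>E V. \<phi> i \<in> N \<phi>} \<le> card ?S"
    by (metis (no_types, lifting) card_image_le card_mono finite_imageI le_trans)
  also have "\<dots> = (\<Sum>g\<in>?P. card (N g))" using fP N(1) by (intro card_SigmaI) auto
  also have "\<dots> \<le> (\<Sum>g\<in>?P. k)" by (intro sum_mono N(2))
  also have "\<dots> = k * card V ^ (card I - 1)"
    using I by (simp add: card_PiE card_Diff_singleton)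
  finally show ?thesis .
qed

text \<open>
  The vertices that share a hyperedge of size less than \<open>M\<close> with a thin pair \<open>{x, y}\<close>. For a thick
  pair the set is empty, so that its size is always bounded.
\<close>
definition near :: "'b hypergraph \<Rightarrow> nat \<Rightarrow> nat \<Rightarrow> 'b \<Rightarrow> 'b \<Rightarrow> 'b set" where
  "near H m M x y = (if codegree H {x, y} < m
     then \<Union> {h\<in>edges H. card h < M \<and> {x, y} \<subseteq> h} else {})"

lemma near_bound:
  assumes H: "is_hypergraph H"
  shows "finite (near H m M x y)" "card (near H m M x y) \<le> m * M"
proof -
  let ?\<H> = "{h\<in>edges H. card h < M \<and> {x, y} \<subseteq> h}"
  have fin: "finite ?\<H>" using finite_edges[OF H] by simp
  show "finite (near H m M x y)"
    using fin finite_hyperedge[OF H] by (auto simp: near_def)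
  show "card (near H m M x y) \<le> m * M"
  proof (cases "codegree H {x, y} < m")
    case True
    have "card (\<Union> ?\<H>) \<le> (\<Sum>h\<in>?\<H>. card h)" by (rule card_Union_le_sum_card)
    also have "\<dots> \<le> (\<Sum>h\<in>?\<H>. M)" by (intro sum_mono) auto
    also have "\<dots> = card ?\<H> * M" by simp
    also have "\<dots> \<le> m * M"
    proof (rule mult_right_mono)
      have "card ?\<H> \<le> codegree H {x, y}"
        unfolding codegree_def using finite_edges[OF H] by (intro card_mono) auto
      then show "card ?\<H> \<le> m" using True by simp
    qed simp
    finally show ?thesis using True by (simp add: near_def)
  qed (simp add: near_def)
qed

text \<open>
  The values at a further vertex that can spoil a Berge copy when the vertices in \<open>J\<close> are mapped by \<open>\<phi>\<close>:
  values already taken, and values in a small hyperedge that an edge inside \<open>J\<close> could use.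
\<close>
definition forbidden :: "'b hypergraph \<Rightarrow> nat \<Rightarrow> nat \<Rightarrow> 'a set \<Rightarrow> ('a \<Rightarrow> 'b) \<Rightarrow> 'b set" where
  "forbidden H m M J \<phi> = \<phi> ` J \<union> (\<Union>a\<in>J. \<Union>b\<in>J. near H m M (\<phi> a) (\<phi> b))"

lemma forbidden_bound:
  assumes H: "is_hypergraph H" and J: "finite J" "card J \<le> v"
  shows "finite (forbidden H m M J \<phi>)" "card (forbidden H m M J \<phi>) \<le> v + v * (v * (m * M))"
proof -
  show "finite (forbidden H m M J \<phi>)"
    using J near_bound(1)[OF H] by (simp add: forbidden_def)
  have "card (\<Union>b\<in>J. near H m M (\<phi> a) (\<phi> b)) \<le> v * (m * M)" for a
  proof -
    have "card (\<Union>b\<in>J. near H m M (\<phi> a) (\<phi> b)) \<le> (\<Sum>b\<in>J. card (near H m M (\<phi> a) (\<phi> b)))"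
      using J(1) by (rule card_UN_le)
    also have "\<dots> \<le> card J * (m * M)"
      using sum_bounded_above[of J "\<lambda>b. card (near H m M (\<phi> a) (\<phi> b))" "m * M"]
        near_bound(2)[OF H] by simp
    also have "\<dots> \<le> v * (m * M)" using J(2) by (rule mult_right_mono) simp
    finally show ?thesis .
  qed
  note inner = this
  have "card (\<Union>a\<in>J. \<Union>b\<in>J. near H m M (\<phi> a) (\<phi> b))
      \<le> (\<Sum>a\<in>J. card (\<Union>b\<in>J. near H m M (\<phi> a) (\<phi> b)))"
    using J(1) by (rule card_UN_le)
  also have "\<dots> \<le> card J * (v * (m * M))"
    using sum_bounded_above[of J "\<lambda>a. card (\<Union>b\<in>J. near H m M (\<phi> a) (\<phi> b))" "v * (m * M)"]
      inner by simp
  also have "\<dots> \<le> v * (v * (m * M))" using J(2) by (rule mult_right_mono) simp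
  finally have "card (\<Union>a\<in>J. \<Union>b\<in>J. near H m M (\<phi> a) (\<phi> b)) \<le> v * (v * (m * M))" .
  moreover have "card (\<phi> ` J) \<le> v" using card_image_le[OF J(1), of \<phi>] J(2) by simp
  ultimately show "card (forbidden H m M J \<phi>) \<le> v + v * (v * (m * M))"
    unfolding forbidden_def by (meson add_mono card_Un_le le_trans)
qed

lemma forbidden_cong: "(\<And>j. j \<in> J \<Longrightarrow> \<phi> j = \<psi> j) \<Longrightarrow> forbidden H m M J \<phi> = forbidden H m M J \<psi>"
  unfolding forbidden_def by simp

text \<open>
  The edge set of the graph to which the removal lemma is applied. It may also contain sets that are
  not pairs; only the images of edges of \<open>F\<close> matter.
\<close>
definition thin_sets :: "'b hypergraph \<Rightarrow> nat \<Rightarrow> nat \<Rightarrow> 'b set set" where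
  "thin_sets H m M = {p. codegree H p < m \<and> (\<exists>h\<in>edges H. card h < M \<and> p \<subseteq> h)}"

text \<open>
  Suppose that no vertex takes a forbidden value. Then \<open>\<phi>\<close> is injective. Choose for each edge of \<open>F\<close> a small
  hyperedge that contains its image. If two edges received the same hyperedge, a vertex \<open>i\<close> of the
  second edge outside the first would take a value near the image of the first. So
  the hyperedges are distinct and \<open>F\<close> has a Berge copy.
\<close>
lemma hom_is_degenerate:
  assumes F: "is_graph F" and H: "is_hypergraph H" "Berge_free F H"
    and \<phi>: "\<phi> \<in> homs F (verts H) (thin_sets H m M)"
  shows "\<exists>i\<in>verts F. \<phi> i \<in> forbidden H m M (verts F - {i}) \<phi>"
proof (rule ccontr)
  assume neg: "\<not> ?thesis"
  note FD = is_graphD[OF F]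
  have inj: "inj_on \<phi> (verts F)"
  proof (rule inj_onI, rule ccontr)
    fix x y assume "x \<in> verts F" "y \<in> verts F" "\<phi> x = \<phi> y" "x \<noteq> y"
    then have "\<phi> x \<in> \<phi> ` (verts F - {x})" by (metis Diff_iff image_eqI singletonD)
    then show False using neg \<open>x \<in> verts F\<close> by (auto simp: forbidden_def)
  qed
  have thin: "\<phi> ` e \<in> thin_sets H m M" if "e \<in> edges F" for e
    using \<phi> that by (simp add: homs_def)
  then have "\<forall>e\<in>edges F. \<exists>h. h \<in> edges H \<and> card h < M \<and> \<phi> ` e \<subseteq> h"
    unfolding thin_sets_def by blast
  then obtain f where f: "\<And>e. e \<in> edges F \<Longrightarrow> f e \<in> edges H \<and> card (f e) < M \<and> \<phi> ` e \<subseteq> f e"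
    by metis
  have "inj_on f (edges F)"
  proof (rule inj_onI, rule ccontr)
    fix e e' assume e: "e \<in> edges F" "e' \<in> edges F" "f e = f e'" "e \<noteq> e'"
    have "\<not> e' \<subseteq> e"
      using e FD(4) by (metis card_subset_eq card.infinite zero_neq_numeral)
    then obtain i where i: "i \<in> e'" "i \<notin> e" by blast
    obtain a b where ab: "e = {a, b}" using FD(4)[OF e(1)] by (auto simp: card_2_iff)
    have iF: "i \<in> verts F" using FD(3)[OF e(2)] i(1) by blast
    have abF: "a \<in> verts F - {i}" "b \<in> verts F - {i}" using FD(3)[OF e(1)] ab i(2) by auto
    have img: "\<phi> ` e = {\<phi> a, \<phi> b}" by (simp add: ab)
    have "f e \<in> {h\<in>edges H. card h < M \<and> {\<phi> a, \<phi> b} \<subseteq> h}" using f[OF e(1)] unfolding img by blast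
    moreover have "\<phi> i \<in> f e" using f[OF e(2)] i(1) e(3) by blast
    moreover have "codegree H {\<phi> a, \<phi> b} < m" using thin[OF e(1)] unfolding img thin_sets_def by blast
    ultimately have "\<phi> i \<in> near H m M (\<phi> a) (\<phi> b)" unfolding near_def by auto
    then have "\<phi> i \<in> forbidden H m M (verts F - {i}) \<phi>" using abF unfolding forbidden_def by blast
    then show False using neg iF by blast
  qed
  moreover have "\<phi> ` verts F \<subseteq> verts H" using \<phi> by (auto simp: homs_def)
  moreover have "f e \<in> edges H \<and> \<phi> ` e \<subseteq> f e" if "e \<in> edges F" for e using f[OF that] by blast
  ultimately show False using Berge_freeD[OF H inj, of f] by blast
qed

lemma card_homs_thin_le:
  assumes F: "is_graph F" and H: "is_hypergraph H" "Berge_free F H"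
  defines "v \<equiv> card (verts F)"
  shows "card (homs F (verts H) (thin_sets H m M))
     \<le> v * ((v + v * (v * (m * M))) * card (verts H) ^ (v - 1))"
proof -
  let ?V = "verts H" let ?k = "v + v * (v * (m * M))"
  let ?D = "\<lambda>i. {\<phi> \<in> verts F \<rightarrow>\<^sub>E ?V. \<phi> i \<in> forbidden H m M (verts F - {i}) \<phi>}"
  have V: "finite ?V" using H(1) by (simp add: is_hypergraph_def)
  note fF = is_graphD(1)[OF F]
  have "homs F ?V (thin_sets H m M) \<subseteq> (\<Union>i\<in>verts F. ?D i)"
  proof
    fix \<phi> assume \<phi>: "\<phi> \<in> homs F ?V (thin_sets H m M)"
    then have "\<phi> \<in> verts F \<rightarrow>\<^sub>E ?V" by (simp add: homs_def)
    then show "\<phi> \<in> (\<Union>i\<in>verts F. ?D i)" using hom_is_degenerate[OF F H \<phi>] by blast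
  qed
  moreover have "finite (\<Union>i\<in>verts F. ?D i)" using fF V by (auto intro!: finite_PiE)
  ultimately have "card (homs F ?V (thin_sets H m M)) \<le> card (\<Union>i\<in>verts F. ?D i)"
    by (rule card_mono[rotated])
  also have "\<dots> \<le> (\<Sum>i\<in>verts F. card (?D i))" using fF by (rule card_UN_le)
  also have "\<dots> \<le> (\<Sum>i\<in>verts F. ?k * card ?V ^ (v - 1))"
  proof (rule sum_mono)
    fix i assume i: "i \<in> verts F"
    have J: "finite (verts F - {i})" "card (verts F - {i}) \<le> v"
      using fF card_mono[of "verts F" "verts F - {i}"] by (auto simp: v_def)
    show "card (?D i) \<le> ?k * card ?V ^ (v - 1)"
      unfolding v_def
    proof (rule card_determined_coordinate[OF fF i V])
      show "finite (forbidden H m M (verts F - {i}) g)" for g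
        by (rule forbidden_bound(1)[OF H(1) J])
      show "card (forbidden H m M (verts F - {i}) g)
          \<le> card (verts F) + card (verts F) * (card (verts F) * (m * M))" for g
        using forbidden_bound(2)[OF H(1) J] unfolding v_def .
      show "forbidden H m M (verts F - {i}) (restrict \<phi> (verts F - {i}))
          = forbidden H m M (verts F - {i}) \<phi>" for \<phi>
        by (rule forbidden_cong) simp
    qed
  qed
  also have "\<dots> = v * (?k * card ?V ^ (v - 1))" by (simp add: v_def)
  finally show ?thesis .
qed

text \<open>
  For large \<open>n\<close> the number \<open>k n\<^bsup>v-1\<^esup>\<close> of degenerate homomorphisms is below the threshold \<open>c n\<^bsup>v\<^esup>\<close> of the
  removal lemma. The resulting set \<open>B\<close> contains a thin pair of every small hyperedge, and a thin pair
  lies in fewer than \<open>m\<close> hyperedges; hence the choice \<open>\<delta> / m\<close> for the size of \<open>B\<close>.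
\<close>
lemma few_small_hyperedges:
  fixes F :: "'a hypergraph" and \<delta> :: real
  assumes F: "is_graph F" and e0: "e0 \<in> edges F" and \<delta>: "\<delta> > 0"
  shows "\<exists>n0::nat. \<forall>H :: 'b hypergraph. n0 \<le> card (verts H) \<longrightarrow> is_hypergraph H \<longrightarrow> Berge_free F H \<longrightarrow>
    (\<forall>h\<in>edges H. ramsey_number F (delete_edge F e0) \<le> card h) \<longrightarrow>
    real (card {h\<in>edges H. card h < M}) \<le> \<delta> * (real (card (verts H)))\<^sup>2"
proof -
  note FD = is_graphD[OF F]
  define m where "m = card (edges F)"
  define v where "v = card (verts F)"
  define k where "k = v * (v + v * (v * (m * M)))"
  have m: "m > 0" using e0 FD(2) by (auto simp: m_def card_gt_0_iff)
  have "e0 \<noteq> {}" using FD(4)[OF e0] by auto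
  then have v: "v > 0" using FD(1) FD(3)[OF e0] by (auto simp: v_def card_gt_0_iff)
  have \<delta>m: "\<delta> / real m > 0" using \<delta> m by simp
  obtain c where c: "c > 0" and rem: "\<And>(V::'b set) G. finite V \<Longrightarrow>
    real (card (homs F V G)) < c * real (card V) ^ card (verts F) \<Longrightarrow>
    \<exists>B\<subseteq>G. finite B \<and> real (card B) \<le> \<delta> / real m * (real (card V))\<^sup>2 \<and>
       (\<forall>\<phi>\<in>homs F V G. \<exists>e\<in>edges F. \<phi> ` e \<in> B)"
    using graph_removal[OF F \<delta>m, where 'b = 'b] by meson
  obtain n0 :: nat where n0: "real n0 > real k / c" using reals_Archimedean2 by blast
  have "real (card {h\<in>edges H. card h < M}) \<le> \<delta> * (real (card (verts H)))\<^sup>2"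
    if n: "n0 \<le> card (verts H)" and H: "is_hypergraph H" "Berge_free F H"
      and big: "\<And>h. h \<in> edges H \<Longrightarrow> ramsey_number F (delete_edge F e0) \<le> card h"
    for H :: "'b hypergraph"
  proof -
    define N where "N = real (card (verts H))"
    have N: "N > real k / c" using n n0 by (simp add: N_def)
    have "real k / c \<ge> 0" using c by simp
    then have N0: "N > 0" using N by linarith
    have V: "finite (verts H)" using H(1) by (simp add: is_hypergraph_def)
    let ?G = "thin_sets H m M"
    have "card (homs F (verts H) ?G) \<le> k * card (verts H) ^ (v - 1)"
      using card_homs_thin_le[OF F H, of m M] by (simp add: k_def v_def mult.assoc)
    then have "real (card (homs F (verts H) ?G)) \<le> real (k * card (verts H) ^ (v - 1))"
      by (rule of_nat_mono)
    also have "\<dots> = real k * N ^ (v - 1)" by (simp add: N_def)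
    also have "\<dots> < c * N * N ^ (v - 1)"
      using N N0 c by (intro mult_strict_right_mono) (simp_all add: divide_less_eq mult.commute)
    also have "\<dots> = c * N ^ v" using v by (cases v) auto
    finally have "real (card (homs F (verts H) ?G)) < c * real (card (verts H)) ^ card (verts F)"
      by (simp add: N_def v_def)
    from rem[OF V this] obtain B where B: "B \<subseteq> ?G" "finite B"
      "real (card B) \<le> \<delta> / real m * N\<^sup>2"
      "\<And>\<phi>. \<phi> \<in> homs F (verts H) ?G \<Longrightarrow> \<exists>e\<in>edges F. \<phi> ` e \<in> B"
      unfolding N_def by blast
    let ?small = "{h\<in>edges H. card h < M}"
    have cover: "?small \<subseteq> (\<Union>p\<in>B. {h\<in>edges H. p \<subseteq> h})"
    proof
      fix h assume h: "h \<in> ?small"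
      then have hE: "h \<in> edges H" "card h < M" by auto
      obtain \<psi> where \<psi>: "\<psi> ` verts F \<subseteq> h" "\<And>e. e \<in> edges F \<Longrightarrow> codegree H (\<psi> ` e) < m"
        using thin_copy[OF F e0 H hE(1) order_refl big[OF hE(1)]] unfolding m_def by blast
      let ?\<phi> = "restrict \<psi> (verts F)"
      have img: "?\<phi> ` e = \<psi> ` e" "\<psi> ` e \<subseteq> h" if "e \<in> edges F" for e
        using FD(3)[OF that] \<psi>(1) by auto
      have "h \<subseteq> verts H" using hE(1) H(1) by (auto simp: is_hypergraph_def)
      then have "?\<phi> \<in> verts F \<rightarrow>\<^sub>E verts H" using \<psi>(1) by auto
      moreover have "?\<phi> ` e \<in> ?G" if "e \<in> edges F" for e
        using img[OF that] \<psi>(2)[OF that] hE unfolding thin_sets_def by auto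
      ultimately have "?\<phi> \<in> homs F (verts H) ?G" by (simp add: homs_def)
      then obtain e where e: "e \<in> edges F" "?\<phi> ` e \<in> B" using B(4) by blast
      then have "\<psi> ` e \<in> B" "\<psi> ` e \<subseteq> h" using img[OF e(1)] by simp_all
      then show "h \<in> (\<Union>p\<in>B. {h\<in>edges H. p \<subseteq> h})" using hE(1) by blast
    qed
    have "card ?small \<le> card (\<Union>p\<in>B. {h\<in>edges H. p \<subseteq> h})"
      using cover B(2) finite_edges[OF H(1)] by (intro card_mono) auto
    also have "\<dots> \<le> (\<Sum>p\<in>B. codegree H p)"
      unfolding codegree_def using B(2) by (rule card_UN_le)
    also have "\<dots> \<le> (\<Sum>p\<in>B. m)"
    proof (rule sum_mono)
      fix p assume "p \<in> B"
      then have "codegree H p < m" using B(1) unfolding thin_sets_def by blast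
      then show "codegree H p \<le> m" by simp
    qed
    also have "\<dots> = card B * m" by simp
    finally have "real (card ?small) \<le> real (card B * m)" by (rule of_nat_mono)
    also have "\<dots> = real (card B) * real m" by simp
    also have "\<dots> \<le> \<delta> / real m * N\<^sup>2 * real m" using B(3) by (rule mult_right_mono) simp
    also have "\<dots> = \<delta> * N\<^sup>2" using m by simp
    finally show ?thesis by (simp add: N_def)
  qed
  then show ?thesis by (intro exI[of _ n0]) blast
qed

section \<open>The weight of Berge-free hypergraphs\<close>

theorem theorem5:
  fixes F :: "'a hypergraph" and e :: "'a set" and w :: "nat \<Rightarrow> nat"
  assumes "is_graph F"
    and "e \<in> edges F"
    and "\<And>m. m > 0 \<Longrightarrow> w m > 0"
    and "(\<lambda>m. real (w m)) \<in> o(\<lambda>m. (real m)\<^sup>2)"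
  shows "\<forall>\<epsilon>::real. \<epsilon> > 0 \<longrightarrow> (\<exists>n\<^sub>0::nat. \<forall>n\<ge>n\<^sub>0. \<forall>H :: 'b hypergraph.
           is_hypergraph H \<and> card (verts H) = n \<and> Berge_free F H \<and>
           (\<forall>h\<in>edges H. card h \<ge> ramsey_number F (delete_edge F e)) \<longrightarrow>
           real (\<Sum>h\<in>edges H. w (card h)) \<le> \<epsilon> * (real n)\<^sup>2)"
proof (intro allI impI)
  fix \<epsilon> :: real assume \<epsilon>: "\<epsilon> > 0"
  note F = assms(1) and e0 = assms(2)
  define R where "R = ramsey_number F (delete_edge F e)"
  define m where "m = card (edges F)"
  \<comment> \<open>The constants \<open>\<eta>\<close> and \<open>\<delta>\<close> make large and small hyperedges contribute at most \<open>\<epsilon>/2 n\<^sup>2\<close> each;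
    the summand \<open>1\<close> avoids division by zero.\<close>
  define \<eta> where "\<eta> = \<epsilon> / (8 * (real R * real m + 1))"
  have \<eta>: "\<eta> > 0" using \<epsilon> by (simp add: \<eta>_def add_nonneg_pos)
  have "eventually (\<lambda>k. norm (real (w k)) \<le> \<eta> * norm ((real k)\<^sup>2)) at_top"
    using landau_o.smallD[OF assms(4) \<eta>] .
  then obtain M0 where M0: "\<And>k. k \<ge> M0 \<Longrightarrow> real (w k) \<le> \<eta> * (real k)\<^sup>2"
    by (auto simp: eventually_at_top_linorder)
  \<comment> \<open>From the size \<open>M\<close> on, both the bound on \<open>w\<close> and the bound by thin pairs are available.\<close>
  define M where "M = max M0 (4 * R)"
  \<comment> \<open>Below the size \<open>M\<close> the weight is bounded by a constant, here crudely the sum of its values;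
    \<open>w 0\<close>, the weight of an empty hyperedge, is one of them.\<close>
  define W where "W = (\<Sum>k<M. w k)"
  define \<delta> where "\<delta> = \<epsilon> / (2 * (real W + 1))"
  have \<delta>: "\<delta> > 0" using \<epsilon> by (simp add: \<delta>_def add_nonneg_pos)
  obtain n0 where n0: "\<And>H :: 'b hypergraph. n0 \<le> card (verts H) \<Longrightarrow> is_hypergraph H \<Longrightarrow>
      Berge_free F H \<Longrightarrow> \<forall>h\<in>edges H. ramsey_number F (delete_edge F e) \<le> card h \<Longrightarrow>
      real (card {h\<in>edges H. card h < M}) \<le> \<delta> * (real (card (verts H)))\<^sup>2"
    using few_small_hyperedges[OF F e0 \<delta>, of M, where 'b = 'b] by blast
  show "\<exists>n\<^sub>0::nat. \<forall>n\<ge>n\<^sub>0. \<forall>H :: 'b hypergraph.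
           is_hypergraph H \<and> card (verts H) = n \<and> Berge_free F H \<and>
           (\<forall>h\<in>edges H. card h \<ge> ramsey_number F (delete_edge F e)) \<longrightarrow>
           real (\<Sum>h\<in>edges H. w (card h)) \<le> \<epsilon> * (real n)\<^sup>2"
  proof (intro exI[of _ n0] allI impI)
    fix n and H :: "'b hypergraph"
    assume n: "n0 \<le> n" and "is_hypergraph H \<and> card (verts H) = n \<and> Berge_free F H \<and>
           (\<forall>h\<in>edges H. card h \<ge> ramsey_number F (delete_edge F e))"
    then have H: "is_hypergraph H" "Berge_free F H" and nH: "card (verts H) = n"
      and big: "\<forall>h\<in>edges H. ramsey_number F (delete_edge F e) \<le> card h" by auto
    let ?S = "{h\<in>edges H. card h < M}" let ?L = "{h\<in>edges H. \<not> card h < M}"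
    let ?w = "\<lambda>h. real (w (card h))"
    note fin = finite_edges[OF H(1)]
    have "?S \<union> ?L = edges H" "?S \<inter> ?L = {}" by auto
    then have split: "(\<Sum>h\<in>edges H. ?w h) = (\<Sum>h\<in>?S. ?w h) + (\<Sum>h\<in>?L. ?w h)"
      using fin sum.union_disjoint[of ?S ?L ?w] by simp
    have small: "(\<Sum>h\<in>?S. ?w h) \<le> \<epsilon> / 2 * (real n)\<^sup>2"
    proof -
      have "?w h \<le> real W" if "h \<in> ?S" for h
      proof -
        have "w (card h) \<le> W" unfolding W_def using that by (intro member_le_sum) auto
        then show ?thesis by simp
      qed
      then have "(\<Sum>h\<in>?S. ?w h) \<le> real (card ?S) * real W"
        using sum_bounded_above[of ?S ?w "real W"] by simp
      also have "\<dots> \<le> \<delta> * (real n)\<^sup>2 * (real W + 1)"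
        using n0[of H] n nH H big \<delta> by (intro mult_mono) auto
      also have "\<dots> = \<epsilon> / 2 * (real n)\<^sup>2"
      proof -
        have "real W + 1 > 0" by (simp add: add_nonneg_pos)
        then show ?thesis by (simp add: \<delta>_def field_simps)
      qed
      finally show ?thesis .
    qed
    have large: "(\<Sum>h\<in>?L. ?w h) \<le> \<epsilon> / 2 * (real n)\<^sup>2"
    proof -
      have "(\<Sum>h\<in>?L. ?w h) \<le> (\<Sum>h\<in>?L. \<eta> * real (4 * R * card (thin_pairs H m h)))"
      proof (rule sum_mono)
        fix h assume "h \<in> ?L"
        then have h: "h \<in> edges H" "M0 \<le> card h" "4 * R \<le> card h" by (auto simp: M_def)
        have "?w h \<le> \<eta> * (real (card h))\<^sup>2" using h(2) by (rule M0)
        also have "\<dots> \<le> \<eta> * real (4 * R * card (thin_pairs H m h))"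
        proof (rule mult_left_mono)
          have "(card h)\<^sup>2 \<le> 4 * R * card (thin_pairs H m h)"
            using hyperedge_square_le_thin_pairs[OF F e0 H h(1)] h(3) by (simp add: R_def m_def)
          then have "real ((card h)\<^sup>2) \<le> real (4 * R * card (thin_pairs H m h))"
            by (rule of_nat_mono)
          then show "(real (card h))\<^sup>2 \<le> real (4 * R * card (thin_pairs H m h))" by simp
        qed (use \<eta> in simp)
        finally show "?w h \<le> \<eta> * real (4 * R * card (thin_pairs H m h))" .
      qed
      also have "\<dots> \<le> (\<Sum>h\<in>edges H. \<eta> * real (4 * R * card (thin_pairs H m h)))"
        using fin \<eta> by (intro sum_mono2) auto
      also have "\<dots> = \<eta> * real (4 * R) * real (\<Sum>h\<in>edges H. card (thin_pairs H m h))"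
        by (simp add: sum_distrib_left mult.assoc)
      also have "\<dots> \<le> \<eta> * real (4 * R) * real (m * n\<^sup>2)"
        using sum_thin_pairs_le[OF H(1), of m] \<eta> unfolding nH
        by (intro mult_left_mono of_nat_mono) auto
      also have "\<dots> = 4 * (\<eta> * (real R * real m)) * (real n)\<^sup>2" by simp
      also have "\<dots> \<le> 4 * (\<eta> * (real R * real m + 1)) * (real n)\<^sup>2"
        using \<eta> by (intro mult_right_mono mult_left_mono) auto
      also have "\<eta> * (real R * real m + 1) = \<epsilon> / 8"
      proof -
        have "real R * real m + 1 > 0" by (simp add: add_nonneg_pos)
        then show ?thesis unfolding \<eta>_def by (simp add: field_simps)
      qed
      finally show ?thesis by simp
    qed
    have "real (\<Sum>h\<in>edges H. w (card h)) = (\<Sum>h\<in>edges H. ?w h)" by simp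
    also have "\<dots> \<le> \<epsilon> / 2 * (real n)\<^sup>2 + \<epsilon> / 2 * (real n)\<^sup>2"
      unfolding split by (rule add_mono[OF small large])
    also have "\<dots> = \<epsilon> * (real n)\<^sup>2" by simp
    finally show "real (\<Sum>h\<in>edges H. w (card h)) \<le> \<epsilon> * (real n)\<^sup>2" .
  qed
qed

end
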